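(* Let $\alpha>0$ and let $H_1,H_2,\ldots$ be i.i.d. nonnegative random variables such that $x\mapsto P(H_1>x)$ is regularly varying at infinity with exponent $-\alpha$. For each $n$ let $X_1,\ldots,X_n$ be the associated sample with truncated power tails, with truncation level $M_n>0$ (see context), and let $h_{n,k}$ be its Hill statistic. Assume that $\lim_{n\to\infty}nP(H_1>M_n)=0$ (soft truncation regime). Let $\gamma,\beta\in(0,1)$ and $$\hat k_n=\Bigl[n\Bigl(\frac1n\sum_{j=1}^n\mathbf 1\bigl(X_j>\gamma\max_{i=1,\ldots,n}X_i\bigr)\Bigr)^\beta\Bigr],$$ where $[\cdot]$ denotes the integer part. Then $h_{n,\hat k_n}\to1/\alpha$ in probability as $n\to\infty$.
   Context: Truncated model: $R_1,R_2,\ldots$ are i.i.d. nonnegative random variables independent of $(H_j)$, $M_n>0$ is deterministic, and for each $n$ the sample is $X_j=X_{nj}$, $j=1,\ldots,n$, where $$X_{nj}=H_j\mathbf 1(H_j\le M_n)+(M_n+R_j)\mathbf 1(H_j>M_n).$$ Hill statistic: with $X_{(1)}\ge X_{(2)}\ge\cdots\ge X_{(n)}$ the order statistics of $X_1,\ldots,X_n$, $$h_{n,k}=\frac1k\sum_{i=1}^k\log\frac{X_{(i)}}{X_{(k)}},\quad k=1,\ldots,n$$ (defined arbitrarily when $k=0$ or $X_{(k)}=0$). *)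

theory Defs
  imports "HOL-Probability.Probability"
begin

definition regularly_varying :: "(real \<Rightarrow> real) \<Rightarrow> real \<Rightarrow> bool" where
  "regularly_varying f \<rho> \<longleftrightarrow>
     (\<exists>a. set_borel_measurable borel {a..} f \<and> (\<forall>x\<ge>a. f x > 0)) \<and>
     (\<forall>t>0. ((\<lambda>x. f (t * x) / f x) \<longlongrightarrow> t powr \<rho>) at_top)"

text \<open>Measurability is part of the definition because \<^const>\<open>measure\<close> is \<open>0\<close> on
  non-measurable sets.\<close>

definition tendsto_in_probability ::
    "'a measure \<Rightarrow> (nat \<Rightarrow> 'a \<Rightarrow> real) \<Rightarrow> real \<Rightarrow> bool" where
  "tendsto_in_probability P Y c \<longleftrightarrow>
     (\<forall>n. Y n \<in> borel_measurable P) \<and>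
     (\<forall>\<epsilon>>0. (\<lambda>n. \<P>(\<omega> in P. \<bar>Y n \<omega> - c\<bar> > \<epsilon>)) \<longlonglongrightarrow> 0)"

definition iid_real :: "'a measure \<Rightarrow> (nat \<Rightarrow> 'a \<Rightarrow> real) \<Rightarrow> bool" where
  "iid_real P Y \<longleftrightarrow>
     prob_space.indep_vars P (\<lambda>_. borel) Y {1..} \<and>
     (\<forall>j\<ge>1. distr P borel (Y j) = distr P borel (Y 1))"

definition indep_sequences ::
    "'a measure \<Rightarrow> (nat \<Rightarrow> 'a \<Rightarrow> real) \<Rightarrow> (nat \<Rightarrow> 'a \<Rightarrow> real) \<Rightarrow> bool" where
  "indep_sequences P Y Z \<longleftrightarrow>
     prob_space.indep_var P
       (PiM {1..} (\<lambda>_. borel)) (\<lambda>\<omega>. \<lambda>j\<in>{1..}. Y j \<omega>)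
       (PiM {1..} (\<lambda>_. borel)) (\<lambda>\<omega>. \<lambda>j\<in>{1..}. Z j \<omega>)"

definition truncated_sample ::
    "(nat \<Rightarrow> real) \<Rightarrow> (nat \<Rightarrow> 'a \<Rightarrow> real) \<Rightarrow> (nat \<Rightarrow> 'a \<Rightarrow> real) \<Rightarrow> nat \<Rightarrow> 'a \<Rightarrow> nat \<Rightarrow> real" where
  "truncated_sample M H R n \<omega> j =
     H j \<omega> * of_bool (H j \<omega> \<le> M n) + (M n + R j \<omega>) * of_bool (H j \<omega> > M n)"

text \<open>In the following, a sample of size \<open>n\<close> is given by the values of \<open>x\<close> at \<open>1, \<dots>, n\<close>;
  \<open>order_stat n x i\<close> is its \<open>i\<close>-th largest value, with multiplicity, for \<open>1 \<le> i \<le> n\<close>.\<close>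

definition order_stat :: "nat \<Rightarrow> (nat \<Rightarrow> real) \<Rightarrow> nat \<Rightarrow> real" where
  "order_stat n x i = rev (sort (map x [1..<Suc n])) ! (i - 1)"

text \<open>The parameter \<open>d\<close> is the arbitrary value taken where the Hill statistic is undefined.\<close>

definition hill :: "real \<Rightarrow> nat \<Rightarrow> (nat \<Rightarrow> real) \<Rightarrow> nat \<Rightarrow> real" where
  "hill d n x k =
     (if k = 0 \<or> order_stat n x k = 0 then d
      else 1 / real k * (\<Sum>i=1..k. ln (order_stat n x i / order_stat n x k)))"

definition k_hat :: "real \<Rightarrow> real \<Rightarrow> nat \<Rightarrow> (nat \<Rightarrow> real) \<Rightarrow> nat" where
  "k_hat \<gamma> \<beta> n x =
     nat \<lfloor>real n * (1 / real n * (\<Sum>j=1..n. of_bool (x j > \<gamma> * Max (x ` {1..n})))) powr \<beta>\<rfloor>"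

end

theory Submission
  imports Defs
begin

text \<open>
  Since \<open>n P(H\<^sub>1 > M\<^sub>n) \<rightarrow> 0\<close>, with probability tending to one no observation is truncated and
  \<open>X\<^sub>j = H\<^sub>j\<close> for all \<open>j \<le> n\<close>. For the untruncated sample write \<open>F\<close> for the tail, \<open>N(v)\<close> for the
  number of observations above \<open>v\<close> and \<open>S(v) = \<Sum>\<^sub>j log\<^sup>+ (H\<^sub>j / v)\<close>. Let \<open>u\<^sub>n \<rightarrow> \<infinity>\<close> be such that
  \<open>w\<^sub>n = n F(u\<^sub>n) \<rightarrow> \<infinity>\<close>. Chebyshev's inequality gives \<open>N(t u\<^sub>n) / w\<^sub>n \<rightarrow> t\<^sup>-\<^sup>\<alpha>\<close> in probability for each
  \<open>t > 0\<close>. Up to a factor close to one, \<open>S(u)\<close> is \<open>log b\<close> times the sum of the \<open>N(b\<^sup>i u)\<close>, for \<open>b\<close>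
  close to one; the tail of this sum is controlled by Markov's inequality and the geometric decay
  of \<open>F(b\<^sup>i u)\<close>, and \<open>log b / (1 - b\<^sup>-\<^sup>\<alpha>) \<rightarrow> 1/\<alpha>\<close> yields \<open>S(t u\<^sub>n) / w\<^sub>n \<rightarrow> t\<^sup>-\<^sup>\<alpha> / \<alpha>\<close>. Now
  \<open>k h\<^sub>n\<^sub>,\<^sub>k = S(X\<^sub>(\<^sub>k\<^sub>))\<close>, the function \<open>S\<close> is decreasing, and \<open>X\<^sub>(\<^sub>k\<^sub>) > v\<close> iff \<open>N(v) \<ge> k\<close>; comparing with finitely
  many levels \<open>t u\<^sub>n\<close> therefore gives \<open>h\<^sub>n\<^sub>,\<^sub>k \<rightarrow> 1/\<alpha>\<close> uniformly over \<open>w\<^sub>n \<le> k \<le> C w\<^sub>n\<close>. Finally, the number of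
  observations above \<open>\<gamma>\<close> times the maximum is at least one and tight, so with \<open>w\<^sub>n\<close> of order \<open>n\<^sup>1\<^sup>-\<^sup>\<beta>\<close>
  the random index lies in such a range with probability close to one.
\<close>

section \<open>Regularly varying tails\<close>

lemma sum_geometric_le:
  fixes q :: real
  assumes "0 \<le> q" "q < 1"
  shows "(\<Sum>i=m..<n. q ^ i) \<le> q ^ m / (1 - q)"
proof (cases "m \<le> n")
  case True
  have "(1 - q) * (\<Sum>i=m..<n. q ^ i) = q ^ m - q ^ n"
    using True
  proof (induction n rule: dec_induct)
    case (step n)
    have "(1 - q) * (\<Sum>i=m..<Suc n. q ^ i) = (1 - q) * (\<Sum>i=m..<n. q ^ i) + (1 - q) * q ^ n"
      using step by (simp add: distrib_left)
    also have "\<dots> = q ^ m - q ^ Suc n" unfolding step.IH by (simp add: algebra_simps)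
    finally show ?case .
  qed simp
  also have "\<dots> \<le> q ^ m" using assms by simp
  finally show ?thesis using assms by (simp add: field_simps)
qed (use assms in simp)

locale rv_tail =
  fixes F :: "real \<Rightarrow> real" and \<alpha> :: real
  assumes alpha_pos: "\<alpha> > 0"
    and tail_antimono: "x \<le> y \<Longrightarrow> F y \<le> F x"
    and tail_pos: "F x > 0"
    and tail_ratio: "t > 0 \<Longrightarrow> ((\<lambda>x. F (t * x) / F x) \<longlongrightarrow> t powr (- \<alpha>)) at_top"
begin

text \<open>One threshold for the ratio at \<open>t\<close> serves all \<open>i\<close>: since
  \<open>t > 1\<close>, the points \<open>t ^ i * u\<close> stay above it once \<open>u\<close>
  does, and the bound is iterated. Uniformity in \<open>i\<close> is what later allows summing over
  arbitrarily many levels.\<close>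

lemma tail_geometric_decay:
  assumes "t > 1" "t powr (- \<alpha>) < q"
  shows "\<forall>\<^sub>F u in at_top. \<forall>i. F (t ^ i * u) \<le> q ^ i * F u"
proof -
  have "\<forall>\<^sub>F x in at_top. F (t * x) / F x < q"
    using tail_ratio assms by (intro order_tendstoD) auto
  then obtain z where z: "\<And>x. x \<ge> z \<Longrightarrow> F (t * x) / F x < q"
    by (auto simp: eventually_at_top_linorder)
  have q: "q > 0"
    using assms by (meson less_le_trans powr_ge_zero le_less_trans)
  have "F (t ^ i * u) \<le> q ^ i * F u" if "u \<ge> max z 1" for u i
  proof (induction i)
    case (Suc i)
    have "t ^ i \<ge> 1" using assms by simp
    hence "t ^ i * u \<ge> 1 * u" using that by (intro mult_right_mono) auto
    hence "z \<le> t ^ i * u" using that by linarith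
    hence "F (t * (t ^ i * u)) / F (t ^ i * u) < q" by (rule z)
    hence "F (t * (t ^ i * u)) < q * F (t ^ i * u)"
      using tail_pos by (simp add: divide_less_eq)
    also have "\<dots> \<le> q * (q ^ i * F u)" using Suc q by simp
    finally show ?case by (simp add: mult_ac)
  qed simp
  thus ?thesis unfolding eventually_at_top_linorder by blast
qed

text \<open>Geometric decay along the points \<open>2 ^ i * u\<close> suffices, since monotonicity
  fills the gaps between them.\<close>

lemma tail_tendsto_0: "(F \<longlongrightarrow> 0) at_top"
proof (rule order_tendstoI)
  fix a :: real
  assume a: "a > 0"
  have "2 powr (- \<alpha>) < 1" using alpha_pos powr_less_mono[of "- \<alpha>" 0 2] by simp
  then obtain q where q: "2 powr (- \<alpha>) < q" "q < 1" using dense by blast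
  have q0: "q > 0" using q by (meson less_le_trans powr_ge_zero le_less_trans)
  obtain u where u: "\<And>i. F (2 ^ i * u) \<le> q ^ i * F u"
    using tail_geometric_decay[of 2 q] q by (auto simp: eventually_at_top_linorder)
  have "(\<lambda>i. q ^ i * F u) \<longlonglongrightarrow> 0 * F u"
    using q q0 by (intro tendsto_mult LIMSEQ_realpow_zero tendsto_const) auto
  hence "\<forall>\<^sub>F i in sequentially. q ^ i * F u < a"
    using a by (intro order_tendstoD) auto
  then obtain i where i: "q ^ i * F u < a" by (auto simp: eventually_sequentially)
  have "F x < a" if "x \<ge> 2 ^ i * u" for x
    using tail_antimono[OF that] u[of i] i by linarith
  thus "\<forall>\<^sub>F x in at_top. F x < a" by (auto simp: eventually_at_top_linorder)
qed (use tail_pos less_trans in \<open>auto intro!: always_eventually\<close>)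

text \<open>\<open>F\<close> may jump, so \<open>F (u n) = p n\<close> need not be solvable.
  Searching among the powers of 2 loses only the factor by which \<open>F\<close> falls over one
  doubling, asymptotically \<open>2 powr (- \<alpha>)\<close>; half of that factor is a lower bound
  that holds eventually.\<close>

lemma tail_quantile_sequence:
  fixes p :: "nat \<Rightarrow> real"
  assumes p: "p \<longlonglongrightarrow> 0" and p_pos: "\<forall>\<^sub>F n in sequentially. p n > 0"
  shows "\<exists>u. filterlim u at_top sequentially \<and>
    (\<forall>\<^sub>F n in sequentially. F (u n) \<le> p n \<and> 2 powr (- \<alpha>) / 2 * p n \<le> F (u n))"
proof -
  define i where "i = (\<lambda>n. LEAST i::nat. F (2 ^ i) \<le> p n)"
  define u where "u = (\<lambda>n. 2 ^ i n :: real)"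
  have le: "F (u n) \<le> p n" if "p n > 0" for n
  proof -
    have "\<forall>\<^sub>F i in sequentially. F (2 ^ i) < p n"
    proof (rule order_tendstoD)
      show "(\<lambda>i. F (2 ^ i)) \<longlonglongrightarrow> 0"
        by (rule filterlim_compose[OF tail_tendsto_0]) real_asymp
    qed fact
    then obtain j where "F (2 ^ j) \<le> p n"
      by (auto simp: eventually_sequentially intro: less_imp_le)
    thus ?thesis unfolding u_def i_def by (rule LeastI)
  qed
  have u: "filterlim u at_top sequentially"
    unfolding filterlim_at_top
  proof
    fix Z :: real
    have "\<forall>\<^sub>F n in sequentially. p n < F Z"
      using p tail_pos by (intro order_tendstoD) auto
    with p_pos show "\<forall>\<^sub>F n in sequentially. Z \<le> u n"
    proof eventually_elim
      case (elim n)
      show ?case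
      proof (rule ccontr)
        assume "\<not> Z \<le> u n"
        hence "F Z \<le> F (u n)" by (intro tail_antimono) auto
        thus False using le elim by fastforce
      qed
    qed
  qed
  have "\<forall>\<^sub>F x in at_top. 2 powr (- \<alpha>) / 2 < F (2 * x) / F x"
    by (rule order_tendstoD[OF tail_ratio]) auto
  \<comment> \<open>The ratio is evaluated at half of \<open>u n\<close>, the last power of 2 at
    which \<open>F\<close> still exceeds \<open>p n\<close>.\<close>
  moreover have "filterlim (\<lambda>n. u n * (1 / 2)) at_top sequentially"
    by (rule filterlim_at_top_mult_tendsto_pos[OF tendsto_const _ u]) auto
  ultimately have "\<forall>\<^sub>F n in sequentially.
      2 powr (- \<alpha>) / 2 < F (2 * (u n * (1 / 2))) / F (u n * (1 / 2))"
    by (rule eventually_compose_filterlim)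
  \<comment> \<open>This excludes \<open>i n = 0\<close>, so that a preceding power of 2
    exists.\<close>
  moreover have "\<forall>\<^sub>F n in sequentially. u n \<ge> 2"
    using u by (simp add: filterlim_at_top)
  ultimately have "\<forall>\<^sub>F n in sequentially. F (u n) \<le> p n \<and> 2 powr (- \<alpha>) / 2 * p n \<le> F (u n)"
    using p_pos
  proof eventually_elim
    case (elim n)
    obtain j where j: "i n = Suc j"
      using elim(2) by (cases "i n") (auto simp: u_def)
    hence uj: "u n * (1 / 2) = 2 ^ j" by (simp add: u_def)
    have "\<not> F (2 ^ j) \<le> p n"
      using not_less_Least[of j "\<lambda>i. F (2 ^ i) \<le> p n"] j unfolding i_def by simp
    hence pj: "p n \<le> F (2 ^ j)" by simp
    have "2 powr (- \<alpha>) / 2 * p n \<le> 2 powr (- \<alpha>) / 2 * F (2 ^ j)"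
      using pj by (intro mult_left_mono) auto
    also have "\<dots> \<le> F (u n)"
      using elim(1) uj tail_pos[of "2 ^ j"] j by (simp add: u_def less_divide_eq)
    finally show ?case using le elim by simp
  qed
  with u show ?thesis by blast
qed

end

text \<open>With \<open>s = ln b\<close> these are \<open>ln b\<close> times the geometric series in
  \<open>b powr (- \<alpha>)\<close> started at exponent 0 and at exponent 1: upper and lower
  Riemann sums of \<open>exp (- (\<alpha> * x))\<close> over the positive half-line, whose integral
  is \<open>1 / \<alpha>\<close>.\<close>

lemma (in rv_tail) log_geometric_limits:
  shows "((\<lambda>s. s / (1 - exp (- (\<alpha> * s)))) \<longlongrightarrow> 1 / \<alpha>) (at_right 0)"
    and "((\<lambda>s. s * exp (- (\<alpha> * s)) / (1 - exp (- (\<alpha> * s)))) \<longlongrightarrow> 1 / \<alpha>) (at_right 0)"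
  using alpha_pos by (real_asymp simp: field_simps)+

lemma (in rv_tail) obtain_base_upper:
  assumes "c > 1 / \<alpha>"
  obtains b where "b > 1" "b powr (- \<alpha>) < 1" "ln b / (1 - b powr (- \<alpha>)) < c"
proof -
  have "\<forall>\<^sub>F s in at_right 0. s / (1 - exp (- (\<alpha> * s))) < c"
    using log_geometric_limits(1) assms by (rule order_tendstoD)
  moreover have "\<forall>\<^sub>F s in at_right 0. (s::real) > 0" by (rule eventually_at_right_less)
  ultimately have "\<forall>\<^sub>F s in at_right 0. (s::real) > 0 \<and> s / (1 - exp (- (\<alpha> * s))) < c"
    by eventually_elim simp
  then obtain s where s: "s > 0" "s / (1 - exp (- (\<alpha> * s))) < c"
    using eventually_happens'[OF trivial_limit_at_right_real] by blast
  show ?thesis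
    using s alpha_pos by (intro that[of "exp s"]) (auto simp: powr_def)
qed

lemma (in rv_tail) obtain_base_lower:
  assumes "c < 1 / \<alpha>"
  obtains b where "b > 1" "b powr (- \<alpha>) < 1" "ln b * b powr (- \<alpha>) / (1 - b powr (- \<alpha>)) > c"
proof -
  have "\<forall>\<^sub>F s in at_right 0. s * exp (- (\<alpha> * s)) / (1 - exp (- (\<alpha> * s))) > c"
    using log_geometric_limits(2) assms by (rule order_tendstoD)
  moreover have "\<forall>\<^sub>F s in at_right 0. (s::real) > 0" by (rule eventually_at_right_less)
  ultimately have "\<forall>\<^sub>F s in at_right 0. (s::real) > 0 \<and> s * exp (- (\<alpha> * s)) / (1 - exp (- (\<alpha> * s))) > c"
    by eventually_elim simp
  then obtain s where s: "s > 0" "s * exp (- (\<alpha> * s)) / (1 - exp (- (\<alpha> * s))) > c"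
    using eventually_happens'[OF trivial_limit_at_right_real] by blast
  show ?thesis
    using s alpha_pos by (intro that[of "exp s"]) (auto simp: powr_def)
qed

text \<open>Regular variation gives positivity only from some point on; monotonicity carries it to
  the whole line.\<close>

lemma regularly_varying_tail:
  assumes "regularly_varying F (- \<alpha>)" "\<alpha> > 0" and anti: "\<And>x y. x \<le> y \<Longrightarrow> F y \<le> F x"
  shows "rv_tail F \<alpha>"
proof
  obtain a where a: "\<And>x. x \<ge> a \<Longrightarrow> F x > 0"
    using assms(1) unfolding regularly_varying_def by blast
  show "F x > 0" for x
    using a[of "max a x"] anti[of x "max a x"] by linarith
  show "((\<lambda>x. F (t * x) / F x) \<longlongrightarrow> t powr (- \<alpha>)) at_top" if "t > 0" for t
    using assms(1) that unfolding regularly_varying_def by blast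
qed (fact assms)+

section \<open>Exceedances and the Hill statistic\<close>

definition exceed :: "nat \<Rightarrow> (nat \<Rightarrow> real) \<Rightarrow> real \<Rightarrow> real" where
  "exceed n x v = (\<Sum>j=1..n. of_bool (x j > v))"

text \<open>The \<open>max 1\<close> encodes the positive part of the logarithm and keeps the
  argument of \<open>ln\<close> positive even for values that are zero or negative.\<close>

definition log_excess :: "nat \<Rightarrow> (nat \<Rightarrow> real) \<Rightarrow> real \<Rightarrow> real" where
  "log_excess n x v = (\<Sum>j=1..n. ln (max 1 (x j / v)))"

lemma exceed_nonneg: "exceed n x v \<ge> 0"
  by (simp add: exceed_def sum_nonneg)

lemma exceed_antimono: "v \<le> w \<Longrightarrow> exceed n x w \<le> exceed n x v"
  unfolding exceed_def by (intro sum_mono) auto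

lemma exceed_le_size: "exceed n x v \<le> real n"
proof -
  have "exceed n x v \<le> (\<Sum>j=1..n. 1)"
    unfolding exceed_def by (intro sum_mono) auto
  thus ?thesis by simp
qed

lemma log_excess_antimono:
  assumes "0 < v" "v \<le> w"
  shows "log_excess n x w \<le> log_excess n x v"
  unfolding log_excess_def
proof (rule sum_mono)
  fix j
  have "max 1 (x j / w) \<le> max 1 (x j / v)"
  \<comment> \<open>For a negative value the quotient increases with the level, but then both maxima
    equal 1.\<close>
  proof (cases "x j \<ge> 0")
    case True
    hence "x j / w \<le> x j / v" using assms by (intro divide_left_mono) auto
    thus ?thesis by auto
  next
    case False
    hence "x j / w \<le> 0" using assms by (simp add: divide_le_0_iff)
    thus ?thesis by auto
  qed
  thus "ln (max 1 (x j / w)) \<le> ln (max 1 (x j / v))" by simp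
qed

text \<open>Each power of \<open>b\<close> counted by the sum accounts for a full step
  \<open>ln b\<close> of \<open>ln y\<close>. The cap \<open>real I * ln b\<close> is carried along
  because the induction needs it when \<open>y > b ^ Suc I\<close>.\<close>

lemma ln_max_ge_sum:
  fixes y b :: real
  assumes "b > 1"
  shows "ln b * (\<Sum>i=1..I. of_bool (y > b ^ i)) \<le> min (real I * ln b) (ln (max 1 y))"
proof (induction I)
  case (Suc I)
  have l: "ln b > 0" using assms by simp
  show ?case
  proof (cases "y > b ^ Suc I")
    case True
    have "ln (b ^ Suc I) \<le> ln (max 1 y)"
      using True assms by (subst ln_le_cancel_iff) (auto simp del: power_Suc)
    hence *: "real (Suc I) * ln b \<le> ln (max 1 y)"
      using assms by (simp only: ln_realpow)
    have "ln b * (\<Sum>i=1..I. of_bool (y > b ^ i)) \<le> real I * ln b"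
      using Suc by simp
    with * show ?thesis using True by (simp add: algebra_simps)
  next
    case False
    hence eq: "(\<Sum>i=1..Suc I. of_bool (y > b ^ i)) = (\<Sum>i=1..I. of_bool (y > b ^ i) :: real)"
      by simp
    moreover have "real I * ln b \<le> real (Suc I) * ln b" using l by simp
    ultimately show ?thesis using Suc unfolding eq by linarith
  qed
qed simp

text \<open>Starting the count at exponent 0 instead of 1 rounds the logarithm up. The minimum
  restricts the claim to the range that \<open>I\<close> steps can cover.\<close>

lemma ln_max_le_sum:
  fixes y b :: real
  assumes "b > 1"
  shows "min (real I * ln b) (ln (max 1 y)) \<le> ln b * (\<Sum>i<I. of_bool (y > b ^ i))"
proof (induction I)
  case (Suc I)
  have l: "ln b > 0" using assms by simp
  show ?case
  proof (cases "y > b ^ I")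
    case True
    have "y > b ^ i" if "i \<le> I" for i
      using True power_increasing[OF that, of b] assms by linarith
    hence "(\<Sum>i<Suc I. of_bool (y > b ^ i)) = (\<Sum>i<Suc I. 1 :: real)"
      by (intro sum.cong) auto
    thus ?thesis by (simp add: algebra_simps)
  next
    case False
    have "ln (max 1 y) \<le> ln (b ^ I)"
      using False assms by (subst ln_le_cancel_iff) auto
    hence "ln (max 1 y) \<le> real I * ln b"
      using assms by (simp only: ln_realpow)
    thus ?thesis using Suc False by simp
  qed
qed simp

lemma log_excess_ge_exceed:
  assumes "b > 1" "v > 0"
  shows "ln b * (\<Sum>i=1..I. exceed n x (b ^ i * v)) \<le> log_excess n x v"
proof -
  have "ln b * (\<Sum>i=1..I. exceed n x (b ^ i * v)) =
      (\<Sum>j=1..n. ln b * (\<Sum>i=1..I. of_bool (x j / v > b ^ i)))"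
    using assms unfolding exceed_def
    by (subst sum.swap) (simp add: sum_distrib_left less_divide_eq)
  also have "\<dots> \<le> log_excess n x v"
    unfolding log_excess_def using ln_max_ge_sum[OF assms(1)] by (intro sum_mono) force
  finally show ?thesis .
qed

text \<open>A count below 1 at level \<open>b ^ I * v\<close> means that no observation lies above
  it, so the cap in \<open>ln_max_le_sum\<close> is inactive for every observation.\<close>

lemma log_excess_le_exceed:
  assumes "b > 1" "v > 0" "exceed n x (b ^ I * v) < 1"
  shows "log_excess n x v \<le> ln b * (\<Sum>i<I. exceed n x (b ^ i * v))"
proof -
  have small: "x j / v \<le> b ^ I" if "j \<in> {1..n}" for j
  proof (rule ccontr)
    assume "\<not> x j / v \<le> b ^ I"
    hence "x j > b ^ I * v" using assms by (simp add: field_simps)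
    moreover have "of_bool (x j > b ^ I * v) \<le> exceed n x (b ^ I * v)"
      unfolding exceed_def using that by (intro member_le_sum) auto
    ultimately show False using assms by simp
  qed
  have "log_excess n x v \<le> (\<Sum>j=1..n. ln b * (\<Sum>i<I. of_bool (x j / v > b ^ i)))"
    unfolding log_excess_def
  proof (rule sum_mono)
    fix j assume j: "j \<in> {1..n}"
    have "ln (max 1 (x j / v)) \<le> ln (b ^ I)"
      using small[OF j] assms by (subst ln_le_cancel_iff) auto
    hence "ln (max 1 (x j / v)) \<le> real I * ln b"
      using assms by (simp only: ln_realpow)
    thus "ln (max 1 (x j / v)) \<le> ln b * (\<Sum>i<I. of_bool (x j / v > b ^ i))"
      using ln_max_le_sum[OF assms(1), of I "x j / v"] by simp
  qed
  also have "\<dots> = ln b * (\<Sum>i<I. exceed n x (b ^ i * v))"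
    using assms(1,2) unfolding exceed_def
    by (subst sum.swap) (simp add: sum_distrib_left less_divide_eq)
  finally show ?thesis .
qed

section \<open>Order statistics and the Hill statistic in terms of exceedances\<close>

lemma sum_order_stat: "(\<Sum>i=1..n. g (order_stat n x i)) = (\<Sum>j=1..n. g (x j))"
proof -
  define ys where "ys = rev (sort (map x [1..<Suc n]))"
  have len: "length ys = n" by (simp add: ys_def)
  have "(\<Sum>i=1..n. g (order_stat n x i)) = (\<Sum>i<n. g (ys ! i))"
    by (rule sum.reindex_bij_witness[of _ Suc "\<lambda>i. i - 1"]) (auto simp: order_stat_def ys_def)
  also have "\<dots> = sum_list (map g ys)"
    by (simp add: sum_list_sum_nth len atLeast0LessThan)
  \<comment> \<open>The sum over a list depends only on its multiset, which sorting and reversing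
    preserve.\<close>
  also have "\<dots> = sum_list (map g (map x [1..<Suc n]))"
  proof -
    have *: "sum_list (map g l) = sum_mset (image_mset g (mset l))" for l :: "real list"
      by (induction l) auto
    show ?thesis unfolding * by (simp only: ys_def mset_rev mset_sort)
  qed
  also have "\<dots> = (\<Sum>j=1..n. g (x j))"
    by (simp only: map_map comp_def interv_sum_list_conv_sum_set_nat set_upt
        atLeastLessThanSuc_atLeastAtMost)
  finally show ?thesis .
qed

lemma order_stat_antimono:
  assumes "1 \<le> i" "i \<le> k" "k \<le> n"
  shows "order_stat n x k \<le> order_stat n x i"
proof -
  define ys where "ys = sort (map x [1..<Suc n])"
  have "ys ! (n - k) \<le> ys ! (n - i)"
    by (rule sorted_nth_mono) (use assms in \<open>auto simp: ys_def\<close>)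
  thus ?thesis using assms unfolding order_stat_def ys_def[symmetric]
    by (subst (1 2) rev_nth) (auto simp: ys_def)
qed

text \<open>The order statistics decrease, so those above \<open>v\<close> form an initial segment
  whose length is \<open>exceed n x v\<close>. This turns statements on sorted lists into statements
  on counts.\<close>

lemma order_stat_greater_iff:
  assumes "1 \<le> k" "k \<le> n"
  shows "order_stat n x k > v \<longleftrightarrow> real k \<le> exceed n x v"
proof -
  have ex: "exceed n x v = (\<Sum>i=1..n. of_bool (order_stat n x i > v))"
    unfolding exceed_def by (rule sum_order_stat[symmetric])
  show ?thesis
  proof
    assume *: "order_stat n x k > v"
    have "real k = (\<Sum>i=1..k. of_bool (order_stat n x i > v))"
      using * order_stat_antimono[of _ k n x] assms by (simp add: order.strict_trans2)
    also have "\<dots> \<le> (\<Sum>i=1..n. of_bool (order_stat n x i > v))"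
      using assms by (intro sum_mono2) auto
    finally show "real k \<le> exceed n x v" by (simp add: ex)
  next
    assume *: "real k \<le> exceed n x v"
    show "order_stat n x k > v"
    proof (rule ccontr)
      assume le: "\<not> order_stat n x k > v"
      \<comment> \<open>All indices from \<open>k\<close> on drop out, which leaves a count of at
        most \<open>k - 1\<close>.\<close>
      have "exceed n x v = (\<Sum>i=1..<k. of_bool (order_stat n x i > v))"
        unfolding ex
      proof (rule sum.mono_neutral_right)
        show "\<forall>i\<in>{1..n} - {1..<k}. of_bool (order_stat n x i > v) = (0::real)"
        proof
          fix i assume i: "i \<in> {1..n} - {1..<k}"
          hence "order_stat n x i \<le> order_stat n x k"
            using assms by (intro order_stat_antimono) auto
          thus "of_bool (order_stat n x i > v) = (0::real)" using le by simp
        qed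
      qed (use assms in auto)
      also have "\<dots> \<le> (\<Sum>i=1..<k. 1)" by (intro sum_mono) auto
      finally show False using * assms by simp
    qed
  qed
qed

text \<open>Beyond index \<open>k\<close> the ratio is at most 1 and contributes
  \<open>ln 1\<close>; up to \<open>k\<close> it is at least 1 and the maximum is inactive.
  Positivity of the \<open>k\<close>-th order statistic rules out the default
  \<open>d\<close>.\<close>

lemma hill_eq_log_excess:
  assumes "1 \<le> k" "k \<le> n" "order_stat n x k > 0"
  shows "hill d n x k = log_excess n x (order_stat n x k) / real k"
proof -
  define c where "c = order_stat n x k"
  have c: "c > 0" using assms by (simp add: c_def)
  have "log_excess n x c = (\<Sum>i=1..n. ln (max 1 (order_stat n x i / c)))"
    unfolding log_excess_def by (rule sum_order_stat[symmetric])
  also have "\<dots> = (\<Sum>i=1..k. ln (max 1 (order_stat n x i / c)))"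
  proof (rule sum.mono_neutral_right)
    show "\<forall>i\<in>{1..n} - {1..k}. ln (max 1 (order_stat n x i / c)) = 0"
    proof
      fix i assume "i \<in> {1..n} - {1..k}"
      hence "order_stat n x i \<le> c"
        unfolding c_def using assms by (intro order_stat_antimono) auto
      hence "order_stat n x i / c \<le> 1" using c by simp
      thus "ln (max 1 (order_stat n x i / c)) = 0" by (simp add: max_absorb1)
    qed
  qed (use assms in auto)
  also have "\<dots> = (\<Sum>i=1..k. ln (order_stat n x i / c))"
  proof (rule sum.cong)
    fix i assume "i \<in> {1..k}"
    hence "order_stat n x i \<ge> c"
      unfolding c_def using assms by (intro order_stat_antimono) auto
    hence "order_stat n x i / c \<ge> 1" using c by simp
    thus "ln (max 1 (order_stat n x i / c)) = ln (order_stat n x i / c)"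
      by (simp add: max_absorb2)
  qed simp
  finally show ?thesis using assms by (simp add: hill_def c_def)
qed

text \<open>The two count conditions place the \<open>k\<close>-th order statistic above
  \<open>v\<close> and at most at \<open>w\<close>, and \<open>log_excess\<close> is decreasing.
  Bounds at two deterministic levels thus control the statistic for every \<open>k\<close> between
  the two counts.\<close>

lemma hill_between:
  fixes x :: "nat \<Rightarrow> real"
  assumes "1 \<le> k" "k \<le> n" "0 < v" "v \<le> w"
    and "exceed n x w < real k" "real k \<le> exceed n x v"
  shows "log_excess n x w \<le> real k * hill d n x k"
    and "real k * hill d n x k \<le> log_excess n x v"
proof -
  have v: "order_stat n x k > v" and w: "order_stat n x k \<le> w"
    using order_stat_greater_iff[where x = x, OF assms(1,2)] assms by (auto simp: not_less[symmetric])
  have eq: "real k * hill d n x k = log_excess n x (order_stat n x k)"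
    using assms v by (subst hill_eq_log_excess) auto
  show "log_excess n x w \<le> real k * hill d n x k"
    unfolding eq using v w assms by (intro log_excess_antimono) auto
  show "real k * hill d n x k \<le> log_excess n x v"
    unfolding eq using v assms by (intro log_excess_antimono) auto
qed

lemma order_stat_cong:
  assumes "\<And>j. j \<in> {1..n} \<Longrightarrow> x j = y j"
  shows "order_stat n x = order_stat n y"
proof -
  have "map x [1..<Suc n] = map y [1..<Suc n]"
    using assms by (intro map_cong) auto
  thus ?thesis unfolding order_stat_def by (simp only:)
qed

lemma hill_cong:
  assumes "\<And>j. j \<in> {1..n} \<Longrightarrow> x j = y j"
  shows "hill d n x = hill d n y"
proof -
  have "order_stat n x = order_stat n y" by (rule order_stat_cong) fact
  thus ?thesis by (simp add: hill_def fun_eq_iff)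
qed

lemma k_hat_cong:
  assumes "\<And>j. j \<in> {1..n} \<Longrightarrow> x j = y j"
  shows "k_hat \<gamma> \<beta> n x = k_hat \<gamma> \<beta> n y"
proof -
  have "x ` {1..n} = y ` {1..n}" using assms by (intro image_cong) auto
  moreover have "(\<Sum>j=1..n. of_bool (x j > c)) = (\<Sum>j=1..n. of_bool (y j > c) :: real)" for c
    using assms by (intro sum.cong) auto
  ultimately show ?thesis unfolding k_hat_def by (simp only:)
qed

lemma k_hat_exceed:
  "k_hat \<gamma> \<beta> n x = nat \<lfloor>real n * (exceed n x (\<gamma> * Max (x ` {1..n})) / real n) powr \<beta>\<rfloor>"
  by (simp add: k_hat_def exceed_def)

lemma k_hat_le:
  assumes "\<beta> > 0"
  shows "k_hat \<gamma> \<beta> n x \<le> n"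
proof -
  let ?q = "exceed n x (\<gamma> * Max (x ` {1..n})) / real n"
  have q: "0 \<le> ?q" "?q \<le> 1"
    using exceed_nonneg[of n x] exceed_le_size[of n x] by (auto simp: divide_le_eq)
  have "real n * ?q powr \<beta> \<le> real n * 1 powr \<beta>"
    using q assms by (intro mult_left_mono powr_mono2) auto
  hence "real n * ?q powr \<beta> \<le> real n" by simp
  thus ?thesis unfolding k_hat_exceed by (simp add: floor_le_iff nat_le_iff)
qed

lemma exceed_ge_1_imp:
  assumes "exceed n x v \<ge> 1"
  shows "\<exists>j\<in>{1..n}. x j > v"
proof (rule ccontr)
  assume "\<not> ?thesis"
  hence "exceed n x v = 0" unfolding exceed_def by (intro sum.neutral) auto
  thus False using assms by simp
qed

lemma exceed_scaled_max_ge_1: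
  assumes "\<gamma> < 1" "1 \<le> n" "Max (x ` {1..n}) > 0"
  shows "exceed n x (\<gamma> * Max (x ` {1..n})) \<ge> 1"
proof -
  have "Max (x ` {1..n}) \<in> x ` {1..n}" using assms by (intro Max_in) auto
  then obtain j where j: "j \<in> {1..n}" "x j = Max (x ` {1..n})" by fastforce
  have "\<gamma> * Max (x ` {1..n}) < Max (x ` {1..n})" using assms by simp
  hence "1 = (of_bool (x j > \<gamma> * Max (x ` {1..n})) :: real)" using j by simp
  also have "\<dots> \<le> exceed n x (\<gamma> * Max (x ` {1..n}))"
    unfolding exceed_def using j by (intro member_le_sum) auto
  finally show ?thesis .
qed

section \<open>Measurability of the order statistics, the random index and the Hill
  statistic\<close>

lemma measurable_order_stat:
  fixes x :: "'a \<Rightarrow> nat \<Rightarrow> real"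
  assumes "\<And>j. j \<in> {1..n} \<Longrightarrow> (\<lambda>\<omega>. x \<omega> j) \<in> borel_measurable P"
    and "1 \<le> k" "k \<le> n"
  shows "(\<lambda>\<omega>. order_stat n (x \<omega>) k) \<in> borel_measurable P"
proof -
  have "(\<lambda>\<omega>. of_bool (x \<omega> j > a) :: real) \<in> borel_measurable P" if "j \<in> {1..n}" for j a
  proof -
    have [measurable]: "(\<lambda>\<omega>. x \<omega> j) \<in> borel_measurable P" using assms that by simp
    show ?thesis unfolding of_bool_def by measurable
  qed
  hence [measurable]: "(\<lambda>\<omega>. exceed n (x \<omega>) a) \<in> borel_measurable P" for a
    unfolding exceed_def by (rule borel_measurable_sum)
  \<comment> \<open>The event that the order statistic exceeds \<open>a\<close> is an event about
    the count of values above \<open>a\<close>, so no measurability of sorting is involved.\<close>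
  show ?thesis
    unfolding borel_measurable_iff_greater order_stat_greater_iff[OF assms(2,3)]
    by measurable
qed

lemma measurable_k_hat:
  fixes x :: "'a \<Rightarrow> nat \<Rightarrow> real"
  assumes "\<And>j. j \<in> {1..n} \<Longrightarrow> (\<lambda>\<omega>. x \<omega> j) \<in> borel_measurable P"
  shows "(\<lambda>\<omega>. k_hat \<gamma> \<beta> n (x \<omega>)) \<in> measurable P (count_space UNIV)"
proof -
  have [measurable]: "(\<lambda>\<omega>. Max (x \<omega> ` {1..n})) \<in> borel_measurable P"
    using assms by (intro borel_measurable_Max) auto
  have "(\<lambda>\<omega>. of_bool (x \<omega> j > \<gamma> * Max (x \<omega> ` {1..n})) :: real) \<in> borel_measurable P"
    if "j \<in> {1..n}" for j
  proof -
    have [measurable]: "(\<lambda>\<omega>. x \<omega> j) \<in> borel_measurable P" using assms that by simp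
    show ?thesis unfolding of_bool_def by measurable
  qed
  hence [measurable]: "(\<lambda>\<omega>. exceed n (x \<omega>) (\<gamma> * Max (x \<omega> ` {1..n}))) \<in> borel_measurable P"
    unfolding exceed_def by (rule borel_measurable_sum)
  show ?thesis unfolding k_hat_exceed by measurable
qed

lemma measurable_hill:
  fixes x :: "'a \<Rightarrow> nat \<Rightarrow> real"
  assumes "\<And>j. j \<in> {1..n} \<Longrightarrow> (\<lambda>\<omega>. x \<omega> j) \<in> borel_measurable P"
    and [measurable]: "d \<in> borel_measurable P" and "k \<le> n"
  shows "(\<lambda>\<omega>. hill (d \<omega>) n (x \<omega>) k) \<in> borel_measurable P"
proof (cases "k = 0")
  case False
  have *: "(\<lambda>\<omega>. order_stat n (x \<omega>) i) \<in> borel_measurable P" if "i \<in> {1..k}" for i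
    by (rule measurable_order_stat) (use that \<open>k \<le> n\<close> in \<open>auto intro: assms(1)\<close>)
  have [measurable]: "(\<lambda>\<omega>. order_stat n (x \<omega>) k) \<in> borel_measurable P"
    using * False by simp
  have "(\<lambda>\<omega>. ln (order_stat n (x \<omega>) i / order_stat n (x \<omega>) k)) \<in> borel_measurable P"
    if "i \<in> {1..k}" for i
  proof -
    have [measurable]: "(\<lambda>\<omega>. order_stat n (x \<omega>) i) \<in> borel_measurable P" using * that .
    show ?thesis by measurable
  qed
  hence [measurable]: "(\<lambda>\<omega>. \<Sum>i=1..k. ln (order_stat n (x \<omega>) i / order_stat n (x \<omega>) k)) \<in> borel_measurable P"
    by (rule borel_measurable_sum)
  show ?thesis unfolding hill_def by measurable
qed (simp add: hill_def)

lemma measurable_hill_k_hat: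
  fixes x :: "'a \<Rightarrow> nat \<Rightarrow> real"
  assumes x: "\<And>j. j \<in> {1..n} \<Longrightarrow> (\<lambda>\<omega>. x \<omega> j) \<in> borel_measurable P"
    and d: "\<And>k. d k \<in> borel_measurable P" and \<beta>: "\<beta> > 0"
  shows "(\<lambda>\<omega>. hill (d (k_hat \<gamma> \<beta> n (x \<omega>)) \<omega>) n (x \<omega>) (k_hat \<gamma> \<beta> n (x \<omega>))) \<in> borel_measurable P"
proof -
  \<comment> \<open>The index takes countably many values, so each fixed \<open>k\<close> can be
    treated separately. Values \<open>k > n\<close>, which \<open>measurable_hill\<close> does not
    cover, are sent to 0; by \<open>k_hat_le\<close> they do not occur.\<close>
  define f where "f = (\<lambda>k \<omega>. if k \<le> n then hill (d k \<omega>) n (x \<omega>) k else 0)"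
  have "f k \<in> borel_measurable P" for k
  proof (cases "k \<le> n")
    case True
    have "(\<lambda>\<omega>. hill (d k \<omega>) n (x \<omega>) k) \<in> borel_measurable P"
      by (rule measurable_hill[OF x d True])
    thus ?thesis using True by (simp add: f_def)
  qed (simp add: f_def)
  hence "(\<lambda>\<omega>. f (k_hat \<gamma> \<beta> n (x \<omega>)) \<omega>) \<in> borel_measurable P"
    by (rule measurable_compose_countable) (intro measurable_k_hat x)
  thus ?thesis using k_hat_le[OF \<beta>] by (simp add: f_def)
qed

section \<open>Events of high probability\<close>

context prob_space
begin

text \<open>The failure sets of the events below involve quantifiers over all \<open>k\<close> and all values \<open>d\<close>, so
  they are only required to be contained in a small measurable set.\<close>

definition eventually_outside :: "real \<Rightarrow> (nat \<Rightarrow> 'a \<Rightarrow> bool) \<Rightarrow> bool" where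
  "eventually_outside \<delta> E \<longleftrightarrow>
     (\<forall>\<^sub>F n in sequentially. \<exists>A\<in>events. prob A \<le> \<delta> \<and> (\<forall>\<omega>\<in>space M - A. E n \<omega>))"

definition whp :: "(nat \<Rightarrow> 'a \<Rightarrow> bool) \<Rightarrow> bool" where
  "whp E \<longleftrightarrow> (\<forall>\<delta>>0. eventually_outside \<delta> E)"

lemma whpD: "whp E \<Longrightarrow> \<delta> > 0 \<Longrightarrow> eventually_outside \<delta> E"
  by (simp add: whp_def)

lemma eventually_outside_mono:
  assumes "eventually_outside \<delta> E"
    and "\<forall>\<^sub>F n in sequentially. \<forall>\<omega>\<in>space M. E n \<omega> \<longrightarrow> E' n \<omega>"
  shows "eventually_outside \<delta> E'"
  using assms unfolding eventually_outside_def by eventually_elim fast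

lemma whp_mono:
  "whp E \<Longrightarrow> \<forall>\<^sub>F n in sequentially. \<forall>\<omega>\<in>space M. E n \<omega> \<longrightarrow> E' n \<omega> \<Longrightarrow> whp E'"
  unfolding whp_def using eventually_outside_mono by blast

lemma eventually_outside_conj:
  assumes "eventually_outside \<delta> E" "eventually_outside \<delta>' E'"
  shows "eventually_outside (\<delta> + \<delta>') (\<lambda>n \<omega>. E n \<omega> \<and> E' n \<omega>)"
  using assms unfolding eventually_outside_def
proof eventually_elim
  case (elim n)
  then obtain A B where AB: "A \<in> events" "prob A \<le> \<delta>" "\<forall>\<omega>\<in>space M - A. E n \<omega>"
      "B \<in> events" "prob B \<le> \<delta>'" "\<forall>\<omega>\<in>space M - B. E' n \<omega>"
    by blast
  have "prob (A \<union> B) \<le> \<delta> + \<delta>'"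
    using measure_Un_le[of A M B] AB by linarith
  thus ?case using AB by (intro bexI[of _ "A \<union> B"]) auto
qed

lemma whp_conj:
  assumes "whp E" "whp E'"
  shows "whp (\<lambda>n \<omega>. E n \<omega> \<and> E' n \<omega>)"
  unfolding whp_def
proof (intro allI impI)
  fix \<delta> :: real assume "\<delta> > 0"
  hence "eventually_outside (\<delta> / 2 + \<delta> / 2) (\<lambda>n \<omega>. E n \<omega> \<and> E' n \<omega>)"
    by (intro eventually_outside_conj whpD assms) auto
  thus "eventually_outside \<delta> (\<lambda>n \<omega>. E n \<omega> \<and> E' n \<omega>)" by simp
qed

lemma whp_finite_ball:
  assumes "finite I" "\<And>i. i \<in> I \<Longrightarrow> whp (E i)"
  shows "whp (\<lambda>n \<omega>. \<forall>i\<in>I. E i n \<omega>)"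
  using assms
proof (induction I rule: finite_induct)
  case empty
  show ?case unfolding whp_def eventually_outside_def
    by (auto intro!: bexI[of _ "{}"] always_eventually)
next
  case (insert i I)
  have "whp (\<lambda>n \<omega>. E i n \<omega> \<and> (\<forall>i\<in>I. E i n \<omega>))"
    using insert by (intro whp_conj) auto
  thus ?case by simp
qed

lemma eventually_outsideI:
  assumes "\<forall>\<^sub>F n in sequentially. {\<omega>\<in>space M. \<not> E n \<omega>} \<in> events \<and> prob {\<omega>\<in>space M. \<not> E n \<omega>} \<le> \<delta>"
  shows "eventually_outside \<delta> E"
  using assms unfolding eventually_outside_def by eventually_elim blast

lemma whpI:
  assumes ev: "\<And>n. {\<omega>\<in>space M. \<not> E n \<omega>} \<in> events"
    and le: "\<forall>\<^sub>F n in sequentially. prob {\<omega>\<in>space M. \<not> E n \<omega>} \<le> b n"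
    and b: "b \<longlonglongrightarrow> 0"
  shows "whp E"
  unfolding whp_def
proof (intro allI impI)
  fix \<delta> :: real assume "\<delta> > 0"
  hence "\<forall>\<^sub>F n in sequentially. b n < \<delta>" using b by (intro order_tendstoD)
  with le have "\<forall>\<^sub>F n in sequentially. prob {\<omega>\<in>space M. \<not> E n \<omega>} \<le> \<delta>"
    by eventually_elim simp
  thus "eventually_outside \<delta> E" using ev by (intro eventually_outsideI) auto
qed

text \<open>The failure set lies in the small covering set. Its own measurability enters here, so
  that its probability is bounded by monotonicity.\<close>

lemma whp_imp_tendsto_0:
  assumes "whp E" "\<And>n. {\<omega>\<in>space M. \<not> E n \<omega>} \<in> events"
  shows "(\<lambda>n. prob {\<omega>\<in>space M. \<not> E n \<omega>}) \<longlonglongrightarrow> 0"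
proof (rule order_tendstoI)
  fix a :: real assume a: "a > 0"
  have "eventually_outside (a / 2) E" using a by (intro whpD assms) auto
  thus "\<forall>\<^sub>F n in sequentially. prob {\<omega>\<in>space M. \<not> E n \<omega>} < a"
    unfolding eventually_outside_def
  proof eventually_elim
    case (elim n)
    then obtain A where A: "A \<in> events" "prob A \<le> a / 2" "\<forall>\<omega>\<in>space M - A. E n \<omega>" by blast
    hence "prob {\<omega>\<in>space M. \<not> E n \<omega>} \<le> prob A"
      by (intro finite_measure_mono) auto
    thus ?case using A a by linarith
  qed
qed (auto intro!: always_eventually less_le_trans[OF _ measure_nonneg])

end

section \<open>Samples with a regularly varying tail\<close>

locale iid_rv_sample = prob_space P + rv_tail F \<alpha>
  for P :: "'a measure" and H :: "nat \<Rightarrow> 'a \<Rightarrow> real" and F \<alpha> +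
  assumes iid: "iid_real P H"
    and tail_eq: "F v = \<P>(\<omega> in P. H 1 \<omega> > v)"
begin

abbreviation sample :: "'a \<Rightarrow> nat \<Rightarrow> real" where
  "sample \<omega> \<equiv> \<lambda>j. H j \<omega>"

lemma random_variable_sample: "j \<ge> 1 \<Longrightarrow> H j \<in> borel_measurable P"
  using iid unfolding iid_real_def by (simp add: indep_vars_def)

lemma prob_exceed:
  assumes "j \<ge> 1"
  shows "\<P>(\<omega> in P. H j \<omega> > v) = F v"
proof -
  have "\<P>(\<omega> in P. H i \<omega> > v) = measure (distr P borel (H i)) {v<..}" if "i \<ge> 1" for i
    using random_variable_sample[OF that]
    by (subst measure_distr) (auto intro!: arg_cong[where f = prob])
  moreover have "distr P borel (H j) = distr P borel (H 1)"
    using iid assms unfolding iid_real_def by blast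
  ultimately show ?thesis using assms by (simp only: tail_eq order_refl)
qed

lemma prob_exceed_pair:
  assumes "i \<ge> 1" "j \<ge> 1" "i \<noteq> j"
  shows "\<P>(\<omega> in P. H i \<omega> > v \<and> H j \<omega> > v) = (F v)\<^sup>2"
proof -
  have iv: "indep_vars (\<lambda>_. borel) H {1..}" using iid by (simp add: iid_real_def)
  have "prob (\<Inter>k\<in>{i, j}. H k -` {v<..} \<inter> space P) = (\<Prod>k\<in>{i, j}. prob (H k -` {v<..} \<inter> space P))"
    by (rule indep_varsD[OF iv]) (use assms in auto)
  moreover have "(\<Inter>k\<in>{i, j}. H k -` {v<..} \<inter> space P) = {\<omega>\<in>space P. H i \<omega> > v \<and> H j \<omega> > v}"
    by auto
  moreover have "H k -` {v<..} \<inter> space P = {\<omega>\<in>space P. H k \<omega> > v}" for k by auto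
  ultimately show ?thesis
    using assms prob_exceed[of i v] prob_exceed[of j v] by (simp add: power2_eq_square)
qed

lemma measurable_exceed [measurable]:
  "(\<lambda>\<omega>. exceed n (sample \<omega>) v) \<in> borel_measurable P"
proof -
  have "(\<lambda>\<omega>. of_bool (H j \<omega> > v) :: real) \<in> borel_measurable P" if "j \<in> {1..n}" for j
  proof -
    have [measurable]: "H j \<in> borel_measurable P" using that by (intro random_variable_sample) auto
    show ?thesis unfolding of_bool_def by measurable
  qed
  thus ?thesis unfolding exceed_def by (rule borel_measurable_sum)
qed

lemma integrable_exceed: "integrable P (\<lambda>\<omega>. exceed n (sample \<omega>) v)"
  by (rule integrable_const_bound[where B = "real n"])
    (simp_all add: exceed_nonneg exceed_le_size)

lemma
  assumes "{\<omega>\<in>space P. Q \<omega>} \<in> events"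
  shows integrable_of_bool: "integrable P (\<lambda>\<omega>. of_bool (Q \<omega>) :: real)"
    and expectation_of_bool: "expectation (\<lambda>\<omega>. of_bool (Q \<omega>)) = \<P>(\<omega> in P. Q \<omega>)"
proof -
  have eq: "of_bool (Q \<omega>) = (indicator {\<omega>\<in>space P. Q \<omega>} \<omega> :: real)" if "\<omega> \<in> space P" for \<omega>
    using that by (simp add: indicator_def)
  show "integrable P (\<lambda>\<omega>. of_bool (Q \<omega>) :: real)"
    using assms by (subst Bochner_Integration.integrable_cong[OF refl eq]) (auto simp: emeasure_eq_measure)
  show "expectation (\<lambda>\<omega>. of_bool (Q \<omega>)) = \<P>(\<omega> in P. Q \<omega>)"
    using assms by (subst Bochner_Integration.integral_cong[OF refl eq]) auto
qed

lemma exceed_event: "j \<ge> 1 \<Longrightarrow> {\<omega>\<in>space P. H j \<omega> > v} \<in> events"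
  using random_variable_sample[of j] by measurable

lemma expectation_exceed: "expectation (\<lambda>\<omega>. exceed n (sample \<omega>) v) = real n * F v"
  unfolding exceed_def
  by (subst Bochner_Integration.integral_sum)
    (simp_all add: integrable_of_bool expectation_of_bool exceed_event prob_exceed)

lemma variance_exceed_le: "variance (\<lambda>\<omega>. exceed n (sample \<omega>) v) \<le> real n * F v"
proof -
  have ev: "{\<omega>\<in>space P. H i \<omega> > v \<and> H j \<omega> > v} \<in> events" if "i \<ge> 1" "j \<ge> 1" for i j
    by (intro sets.sets_Collect_conj exceed_event that)
  have sq: "(exceed n (sample \<omega>) v)\<^sup>2 =
      (\<Sum>i=1..n. \<Sum>j=1..n. (of_bool (H i \<omega> > v \<and> H j \<omega> > v) :: real))" for \<omega>
    unfolding exceed_def power2_eq_square sum_product by (simp add: of_bool_conj)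
  have int: "integrable P (\<lambda>\<omega>. (exceed n (sample \<omega>) v)\<^sup>2)"
    unfolding sq by (intro Bochner_Integration.integrable_sum integrable_of_bool ev) auto
  have "expectation (\<lambda>\<omega>. (exceed n (sample \<omega>) v)\<^sup>2) =
      (\<Sum>i=1..n. \<Sum>j=1..n. \<P>(\<omega> in P. H i \<omega> > v \<and> H j \<omega> > v))"
  proof -
    have "expectation (\<lambda>\<omega>. \<Sum>j=1..n. (of_bool (H i \<omega> > v \<and> H j \<omega> > v) :: real)) =
        (\<Sum>j=1..n. \<P>(\<omega> in P. H i \<omega> > v \<and> H j \<omega> > v))" if "i \<in> {1..n}" for i
    proof -
      have "expectation (\<lambda>\<omega>. \<Sum>j=1..n. (of_bool (H i \<omega> > v \<and> H j \<omega> > v) :: real)) =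
          (\<Sum>j=1..n. expectation (\<lambda>\<omega>. (of_bool (H i \<omega> > v \<and> H j \<omega> > v) :: real)))"
        using that by (intro Bochner_Integration.integral_sum integrable_of_bool ev) auto
      also have "\<dots> = (\<Sum>j=1..n. \<P>(\<omega> in P. H i \<omega> > v \<and> H j \<omega> > v))"
        using that by (intro sum.cong refl expectation_of_bool ev) auto
      finally show ?thesis .
    qed
    moreover have "expectation (\<lambda>\<omega>. (exceed n (sample \<omega>) v)\<^sup>2) =
        (\<Sum>i=1..n. expectation (\<lambda>\<omega>. \<Sum>j=1..n. (of_bool (H i \<omega> > v \<and> H j \<omega> > v) :: real)))"
      unfolding sq
      by (intro Bochner_Integration.integral_sum Bochner_Integration.integrable_sum
          integrable_of_bool ev) auto
    ultimately show ?thesis by simp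
  qed
  \<comment> \<open>An off-diagonal pair contributes exactly the square of \<open>F v\<close>, by
    independence; a diagonal pair contributes \<open>F v\<close>. Subtracting the squared mean
    leaves at most \<open>real n * F v\<close>.\<close>
  also have "\<dots> \<le> (\<Sum>i=1..n. \<Sum>j=1..n. (F v)\<^sup>2 + (if i = j then F v else 0))"
    using prob_exceed prob_exceed_pair by (intro sum_mono) auto
  also have "\<dots> = (real n * F v)\<^sup>2 + real n * F v"
    by (simp add: sum.distrib power2_eq_square algebra_simps)
  finally show ?thesis
    using int by (subst variance_eq) (simp_all add: integrable_exceed expectation_exceed)
qed

lemma exceed_Chebyshev:
  assumes "a > 0"
  shows "\<P>(\<omega> in P. a \<le> \<bar>exceed n (sample \<omega>) v - real n * F v\<bar>) \<le> real n * F v / a\<^sup>2"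
proof -
  have "integrable P (\<lambda>\<omega>. (exceed n (sample \<omega>) v)\<^sup>2)"
    by (rule integrable_const_bound[where B = "(real n)\<^sup>2"])
      (simp_all add: exceed_nonneg exceed_le_size power_mono)
  hence "\<P>(\<omega> in P. a \<le> \<bar>exceed n (sample \<omega>) v - real n * F v\<bar>)
      \<le> variance (\<lambda>\<omega>. exceed n (sample \<omega>) v) / a\<^sup>2"
    using Chebyshev_inequality[of "\<lambda>\<omega>. exceed n (sample \<omega>) v" a] assms
    by (simp add: expectation_exceed)
  also have "\<dots> \<le> real n * F v / a\<^sup>2"
    using variance_exceed_le by (intro divide_right_mono) auto
  finally show ?thesis .
qed

text \<open>Stated for a family of levels so that a long sum of counts is bounded at once, at the
  cost of its expectation only. A single count is the case \<open>I = {0}\<close>.\<close>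

lemma exceed_Markov:
  assumes "a > 0"
  shows "\<P>(\<omega> in P. a \<le> (\<Sum>i\<in>I. exceed n (sample \<omega>) (v i))) \<le> real n * (\<Sum>i\<in>I. F (v i)) / a"
proof -
  have "\<P>(\<omega> in P. a \<le> (\<Sum>i\<in>I. exceed n (sample \<omega>) (v i)))
      \<le> expectation (\<lambda>\<omega>. \<Sum>i\<in>I. exceed n (sample \<omega>) (v i)) / a"
    by (rule integral_Markov_inequality_measure[where A = "{}"])
      (simp_all add: integrable_exceed assms sum_nonneg exceed_nonneg)
  also have "expectation (\<lambda>\<omega>. \<Sum>i\<in>I. exceed n (sample \<omega>) (v i)) = real n * (\<Sum>i\<in>I. F (v i))"
    by (simp add: integrable_exceed expectation_exceed sum_distrib_left)
  finally show ?thesis .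
qed

end

section \<open>Counts and log excesses at levels exceeded by a growing number but a vanishing share
  of the sample\<close>

locale intermediate_level = iid_rv_sample +
  fixes u :: "nat \<Rightarrow> real"
  assumes level_at_top: "filterlim u at_top sequentially"
    and mean_at_top: "filterlim (\<lambda>n. real n * F (u n)) at_top sequentially"
begin

abbreviation mean_exceed :: "nat \<Rightarrow> real" where
  "mean_exceed n \<equiv> real n * F (u n)"

lemma level_ratio: "t > 0 \<Longrightarrow> (\<lambda>n. F (t * u n) / F (u n)) \<longlonglongrightarrow> t powr (- \<alpha>)"
  by (rule filterlim_compose[OF tail_ratio level_at_top])

lemma level_pos: "\<forall>\<^sub>F n in sequentially. u n > 0"
  using level_at_top by (simp add: filterlim_at_top_dense)

lemma mean_pos: "\<forall>\<^sub>F n in sequentially. mean_exceed n > 0"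
  using mean_at_top unfolding filterlim_at_top_dense by blast

text \<open>The ratio of the two means has a positive limit, so both tend to infinity together.
  Results proved at \<open>u n\<close> thereby become available at \<open>t * u n\<close>.\<close>

lemma scale_level:
  assumes "t > 0"
  shows "intermediate_level P H F \<alpha> (\<lambda>n. t * u n)"
proof
  show "filterlim (\<lambda>n. t * u n) at_top sequentially"
    by (rule filterlim_tendsto_pos_mult_at_top[OF tendsto_const assms level_at_top])
  have "filterlim (\<lambda>n. F (t * u n) / F (u n) * mean_exceed n) at_top sequentially"
    by (rule filterlim_tendsto_pos_mult_at_top[OF level_ratio[OF assms] _ mean_at_top])
      (use assms in auto)
  moreover have "F (t * u n) / F (u n) * mean_exceed n = real n * F (t * u n)" for n
    using tail_pos[of "u n"] by simp
  ultimately show "filterlim (\<lambda>n. real n * F (t * u n)) at_top sequentially" by simp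
qed

lemma exceed_level:
  assumes t: "t > 0" and lr: "l < t powr (- \<alpha>)" "t powr (- \<alpha>) < r"
  shows "whp (\<lambda>n \<omega>. l * mean_exceed n < exceed n (sample \<omega>) (t * u n) \<and>
    exceed n (sample \<omega>) (t * u n) < r * mean_exceed n)"
proof -
  \<comment> \<open>The expected count will lie between \<open>l'\<close> and \<open>r'\<close>
    times the mean at \<open>u n\<close>. Leaving the wider window from \<open>l\<close> to
    \<open>r\<close> then forces a deviation of at least \<open>e\<close> times that mean, and
    Chebyshev bounds its probability by a multiple of the reciprocal mean.\<close>
  obtain l' where l': "l < l'" "l' < t powr (- \<alpha>)" using dense lr by blast
  obtain r' where r': "t powr (- \<alpha>) < r'" "r' < r" using dense lr by blast
  define e where "e = min (l' - l) (r - r')"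
  have e: "e > 0" using l' r' by (simp add: e_def)
  have "\<forall>\<^sub>F n in sequentially. l' < F (t * u n) / F (u n)"
      "\<forall>\<^sub>F n in sequentially. F (t * u n) / F (u n) < r'"
    using order_tendstoD[OF level_ratio[OF t]] l' r' by blast+
  hence le: "\<forall>\<^sub>F n in sequentially. \<P>(\<omega> in P. \<not> (l * mean_exceed n < exceed n (sample \<omega>) (t * u n) \<and>
    exceed n (sample \<omega>) (t * u n) < r * mean_exceed n)) \<le> r' / (e\<^sup>2 * mean_exceed n)"
    using mean_pos
  proof eventually_elim
    case (elim n)
    define w where "w = mean_exceed n"
    have w: "w > 0" using elim by (simp add: w_def)
    have F: "l' * w < real n * F (t * u n)" "real n * F (t * u n) < r' * w"
    proof -
      have "real n > 0" using elim(3) tail_pos[of "u n"] by (simp add: zero_less_mult_iff)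
      moreover have "l' * F (u n) < F (t * u n)" "F (t * u n) < r' * F (u n)"
        using elim(1,2) tail_pos[of "u n"] by (auto simp: less_divide_eq divide_less_eq)
      ultimately show "l' * w < real n * F (t * u n)" "real n * F (t * u n) < r' * w"
        unfolding w_def using mult_strict_left_mono[of _ _ "real n"] by (auto simp: mult_ac)
    qed
    have ew: "e * w \<le> (l' - l) * w" "e * w \<le> (r - r') * w"
      using w by (auto simp: e_def intro!: mult_right_mono)
    have "\<P>(\<omega> in P. \<not> (l * w < exceed n (sample \<omega>) (t * u n) \<and> exceed n (sample \<omega>) (t * u n) < r * w))
        \<le> \<P>(\<omega> in P. e * w \<le> \<bar>exceed n (sample \<omega>) (t * u n) - real n * F (t * u n)\<bar>)"
    proof (rule finite_measure_mono)
      show "{\<omega>\<in>space P. \<not> (l * w < exceed n (sample \<omega>) (t * u n) \<and> exceed n (sample \<omega>) (t * u n) < r * w)}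
        \<subseteq> {\<omega>\<in>space P. e * w \<le> \<bar>exceed n (sample \<omega>) (t * u n) - real n * F (t * u n)\<bar>}"
        using F ew by (auto simp: algebra_simps)
    qed measurable
    also have "\<dots> \<le> real n * F (t * u n) / (e * w)\<^sup>2"
      by (rule exceed_Chebyshev) (use e w in simp)
    also have "\<dots> \<le> r' * w / (e * w)\<^sup>2"
      using F by (intro divide_right_mono) auto
    also have "\<dots> = r' / (e\<^sup>2 * w)" using w by (simp add: power2_eq_square)
    finally show ?case by (simp add: w_def)
  qed
  have "filterlim (\<lambda>n. e\<^sup>2 * mean_exceed n) at_top sequentially"
    by (rule filterlim_tendsto_pos_mult_at_top[OF tendsto_const _ mean_at_top]) (use e in auto)
  hence "(\<lambda>n. r' / (e\<^sup>2 * mean_exceed n)) \<longlonglongrightarrow> 0"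
    by (intro tendsto_divide_0[OF tendsto_const] filterlim_at_top_imp_at_infinity)
  with le show ?thesis by (intro whpI) measurable
qed

text \<open>For a lower bound the sum over levels may be cut off at a fixed \<open>I\<close>, so
  finitely many applications of \<open>exceed_level\<close> suffice.\<close>

lemma log_excess_lower:
  assumes "c < 1 / \<alpha>"
  shows "whp (\<lambda>n \<omega>. c * mean_exceed n < log_excess n (sample \<omega>) (u n))"
proof -
  obtain b where b: "b > 1" "b powr (- \<alpha>) < 1" "ln b * b powr (- \<alpha>) / (1 - b powr (- \<alpha>)) > c"
    using obtain_base_lower[OF assms] .
  define q where "q = b powr (- \<alpha>)"
  have q: "0 < q" "q < 1" "ln b * q / (1 - q) > c" using b by (auto simp: q_def)
  have bi: "(b ^ i) powr (- \<alpha>) = q ^ i" for i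
    using b by (simp add: q_def powr_powr powr_realpow[symmetric] mult.commute)
  have "(\<lambda>i. q * q ^ i) sums (q * (1 / (1 - q)))"
    using q by (intro sums_mult geometric_sums) auto
  hence "(\<lambda>I. ln b * (\<Sum>i<I. q * q ^ i)) \<longlonglongrightarrow> ln b * (q * (1 / (1 - q)))"
    unfolding sums_def by (intro tendsto_mult tendsto_const)
  hence "\<forall>\<^sub>F I in sequentially. ln b * (\<Sum>i<I. q * q ^ i) > c"
    using q by (intro order_tendstoD) auto
  then obtain I where I: "ln b * (\<Sum>i<I. q * q ^ i) > c" by (auto simp: eventually_sequentially)
  have sum_eq: "(\<Sum>i<I. q * q ^ i) = (\<Sum>i=1..I. q ^ i)"
    by (rule sum.reindex_bij_witness[of _ "\<lambda>i. i - 1" Suc]) auto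
  \<comment> \<open>The slack \<open>e\<close> is subtracted from each of the \<open>I\<close>
    limits and is taken so small that the total still exceeds \<open>c\<close>.\<close>
  have "((\<lambda>e. ln b * (\<Sum>i=1..I. q ^ i - e)) \<longlongrightarrow> ln b * (\<Sum>i=1..I. q ^ i - 0)) (at_right 0)"
    by (intro tendsto_intros)
  hence "\<forall>\<^sub>F e in at_right 0. ln b * (\<Sum>i=1..I. q ^ i - e) > c"
    using I sum_eq by (intro order_tendstoD) auto
  moreover have "\<forall>\<^sub>F e in at_right 0. (e::real) > 0" by (rule eventually_at_right_less)
  ultimately have "\<forall>\<^sub>F e in at_right 0. e > 0 \<and> ln b * (\<Sum>i=1..I. q ^ i - e) > c"
    by eventually_elim simp
  then obtain e where e: "e > 0" "ln b * (\<Sum>i=1..I. q ^ i - e) > c"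
    using eventually_happens'[OF trivial_limit_at_right_real] by blast
  have "whp (\<lambda>n \<omega>. \<forall>i\<in>{1..I}. (q ^ i - e) * mean_exceed n < exceed n (sample \<omega>) (b ^ i * u n) \<and>
    exceed n (sample \<omega>) (b ^ i * u n) < (q ^ i + e) * mean_exceed n)"
    using b e by (intro whp_finite_ball exceed_level) (auto simp: bi)
  moreover have "\<forall>\<^sub>F n in sequentially. \<forall>\<omega>\<in>space P.
    (\<forall>i\<in>{1..I}. (q ^ i - e) * mean_exceed n < exceed n (sample \<omega>) (b ^ i * u n) \<and>
      exceed n (sample \<omega>) (b ^ i * u n) < (q ^ i + e) * mean_exceed n)
    \<longrightarrow> c * mean_exceed n < log_excess n (sample \<omega>) (u n)"
    using level_pos mean_pos
  proof eventually_elim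
    case (elim n)
    show ?case
    proof (intro ballI impI)
      fix \<omega>
      assume *: "\<forall>i\<in>{1..I}. (q ^ i - e) * mean_exceed n < exceed n (sample \<omega>) (b ^ i * u n) \<and>
        exceed n (sample \<omega>) (b ^ i * u n) < (q ^ i + e) * mean_exceed n"
      have "c * mean_exceed n < ln b * (\<Sum>i=1..I. q ^ i - e) * mean_exceed n"
        using e elim by (intro mult_strict_right_mono) auto
      also have "\<dots> = ln b * (\<Sum>i=1..I. (q ^ i - e) * mean_exceed n)"
        by (simp add: sum_distrib_right mult.assoc)
      also have "\<dots> \<le> ln b * (\<Sum>i=1..I. exceed n (sample \<omega>) (b ^ i * u n))"
        using * b by (intro mult_left_mono sum_mono less_imp_le) auto
      also have "\<dots> \<le> log_excess n (sample \<omega>) (u n)"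
        using b elim by (intro log_excess_ge_exceed) auto
      finally show "c * mean_exceed n < log_excess n (sample \<omega>) (u n)" .
    qed
  qed
  ultimately show ?thesis by (rule whp_mono)
qed

text \<open>Here no level may be dropped. The allowance \<open>\<delta>\<close> is split in three:
  the first \<open>I\<close> levels are handled one by one, the levels from \<open>I\<close> to
  \<open>J n\<close> by a single Markov bound, and the last third excludes observations above level
  \<open>J n\<close>. Since \<open>I\<close> and \<open>J\<close> depend on \<open>\<delta>\<close>,
  it is fixed first.\<close>

lemma log_excess_upper:
  assumes "c > 1 / \<alpha>"
  shows "whp (\<lambda>n \<omega>. log_excess n (sample \<omega>) (u n) < c * mean_exceed n)"
  unfolding whp_def
proof (intro allI impI)
  fix \<delta> :: real assume \<delta>: "\<delta> > 0"
  obtain b where b: "b > 1" "b powr (- \<alpha>) < 1" "ln b / (1 - b powr (- \<alpha>)) < c"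
    using obtain_base_upper[OF assms] .
  define p where "p = b powr (- \<alpha>)"
  have p: "0 < p" "p < 1" "ln b / (1 - p) < c" using b by (auto simp: p_def)
  have bi: "(b ^ i) powr (- \<alpha>) = p ^ i" for i
    using b by (simp add: p_def powr_powr powr_realpow[symmetric] mult.commute)
  \<comment> \<open>Geometric decay uniform in the exponent is available only for a rate strictly
    above the limiting ratio \<open>p\<close>.\<close>
  obtain q where q: "p < q" "q < 1" using dense p by blast
  \<comment> \<open>The gap between \<open>c\<close> and the limiting constant is shared equally:
    one \<open>\<eta>\<close> for the errors at the first \<open>I\<close> levels, one for the
    remaining levels.\<close>
  define \<eta> where "\<eta> = (c - ln b / (1 - p)) / (2 * ln b)"
  have lnb: "ln b > 0" using b by simp
  have \<eta>: "\<eta> > 0" "ln b * (1 / (1 - p) + 2 * \<eta>) = c"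
  proof -
    show "\<eta> > 0" using p lnb by (simp add: \<eta>_def)
    have "2 * ln b * \<eta> = c - ln b / (1 - p)" using lnb by (simp add: \<eta>_def)
    thus "ln b * (1 / (1 - p) + 2 * \<eta>) = c" by (simp add: algebra_simps)
  qed
  \<comment> \<open>This is the Markov bound for the levels from \<open>I\<close> on: their expected
    total is at most \<open>q ^ I / (1 - q)\<close> times the mean, compared with
    \<open>\<eta>\<close> times the mean.\<close>
  have "(\<lambda>I. q ^ I / ((1 - q) * \<eta>)) \<longlonglongrightarrow> 0 / ((1 - q) * \<eta>)"
    using p q \<eta> by (intro tendsto_divide LIMSEQ_realpow_zero tendsto_const) auto
  hence "\<forall>\<^sub>F I in sequentially. q ^ I / ((1 - q) * \<eta>) < \<delta> / 3"
    using \<delta> by (intro order_tendstoD) auto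
  then obtain I where I: "q ^ I / ((1 - q) * \<eta>) < \<delta> / 3" by (auto simp: eventually_sequentially)
  \<comment> \<open>The share of \<open>\<eta>\<close> per level; the added 1 avoids division by
    zero when \<open>I = 0\<close>.\<close>
  define \<eta>' where "\<eta>' = \<eta> / (real I + 1)"
  have \<eta>': "\<eta>' > 0" "real I * \<eta>' \<le> \<eta>" using \<eta> by (auto simp: \<eta>'_def field_simps)

  \<comment> \<open>The cutoff may depend on \<open>n\<close> without any control on its size,
    because the bound for the levels up to it is a geometric series.\<close>
  have "\<exists>J\<ge>I. real n * F (b ^ J * u n) \<le> \<delta> / 3" if "u n > 0" for n
  proof -
    have "filterlim (\<lambda>J. b ^ J * u n) at_top sequentially"
      using b that by real_asymp
    hence "(\<lambda>J. real n * F (b ^ J * u n)) \<longlonglongrightarrow> real n * 0"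
      by (intro tendsto_mult tendsto_const filterlim_compose[OF tail_tendsto_0])
    hence "\<forall>\<^sub>F J in sequentially. real n * F (b ^ J * u n) < \<delta> / 3"
      using \<delta> by (intro order_tendstoD) auto
    then obtain J where "\<And>j. j \<ge> J \<Longrightarrow> real n * F (b ^ j * u n) < \<delta> / 3"
      by (auto simp: eventually_sequentially)
    from this[of "max I J"] show ?thesis by (intro exI[of _ "max I J"]) auto
  qed
  then obtain J where J: "\<And>n. u n > 0 \<Longrightarrow> J n \<ge> I \<and> real n * F (b ^ J n * u n) \<le> \<delta> / 3"
    by metis

  have "eventually_outside (\<delta> / 3) (\<lambda>n \<omega>. \<forall>i\<in>{..<I}.
      (p ^ i - \<eta>') * mean_exceed n < exceed n (sample \<omega>) (b ^ i * u n) \<and>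
      exceed n (sample \<omega>) (b ^ i * u n) < (p ^ i + \<eta>') * mean_exceed n)"
    using b \<eta>' \<delta> by (intro whpD whp_finite_ball exceed_level) (auto simp: bi)
  moreover have "eventually_outside (\<delta> / 3)
      (\<lambda>n \<omega>. (\<Sum>i=I..<J n. exceed n (sample \<omega>) (b ^ i * u n)) < \<eta> * mean_exceed n)"
  proof (rule eventually_outsideI)
    have decay: "\<forall>\<^sub>F n in sequentially. \<forall>i. F (b ^ i * u n) \<le> q ^ i * F (u n)"
      using tail_geometric_decay[of b q] b q level_at_top
      by (auto simp: p_def intro: eventually_compose_filterlim)
    show "\<forall>\<^sub>F n in sequentially.
        {\<omega>\<in>space P. \<not> (\<Sum>i=I..<J n. exceed n (sample \<omega>) (b ^ i * u n)) < \<eta> * mean_exceed n} \<in> events \<and>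
        \<P>(\<omega> in P. \<not> (\<Sum>i=I..<J n. exceed n (sample \<omega>) (b ^ i * u n)) < \<eta> * mean_exceed n) \<le> \<delta> / 3"
      using decay mean_pos
    proof eventually_elim
      case (elim n)
      have "(\<Sum>i=I..<J n. F (b ^ i * u n)) \<le> (\<Sum>i=I..<J n. q ^ i * F (u n))"
        using elim by (intro sum_mono) auto
      also have "\<dots> \<le> q ^ I / (1 - q) * F (u n)"
      proof -
        have "(\<Sum>i=I..<J n. q ^ i) \<le> q ^ I / (1 - q)"
          using p q by (intro sum_geometric_le) auto
        from mult_right_mono[OF this less_imp_le[OF tail_pos[of "u n"]]]
        show ?thesis by (simp only: sum_distrib_right)
      qed
      finally have "real n * (\<Sum>i=I..<J n. F (b ^ i * u n)) \<le> q ^ I / (1 - q) * mean_exceed n"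
        by (metis mult.left_commute mult_left_mono of_nat_0_le_iff)
      hence "real n * (\<Sum>i=I..<J n. F (b ^ i * u n)) / (\<eta> * mean_exceed n)
          \<le> q ^ I / (1 - q) * mean_exceed n / (\<eta> * mean_exceed n)"
        using elim \<eta> by (intro divide_right_mono) auto
      also have "\<dots> = q ^ I / (1 - q) / \<eta>"
        by (rule nonzero_mult_divide_mult_cancel_right) (use elim(2) in linarith)
      also have "\<dots> \<le> \<delta> / 3" using I by simp
      finally show ?case
        using exceed_Markov[where a = "\<eta> * mean_exceed n" and I = "{I..<J n}" and n = n
            and v = "\<lambda>i. b ^ i * u n"] elim \<eta>
        by (simp add: not_less)
    qed
  qed
  moreover have "eventually_outside (\<delta> / 3) (\<lambda>n \<omega>. exceed n (sample \<omega>) (b ^ J n * u n) < 1)"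
  proof (rule eventually_outsideI)
    show "\<forall>\<^sub>F n in sequentially.
        {\<omega>\<in>space P. \<not> exceed n (sample \<omega>) (b ^ J n * u n) < 1} \<in> events \<and>
        \<P>(\<omega> in P. \<not> exceed n (sample \<omega>) (b ^ J n * u n) < 1) \<le> \<delta> / 3"
      using level_pos
    proof eventually_elim
      case (elim n)
      show ?case
        using exceed_Markov[where a = 1 and I = "{0::nat}" and n = n and v = "\<lambda>_. b ^ J n * u n"]
          J[OF elim]
        by (simp add: not_less)
    qed
  qed
  ultimately have "eventually_outside (\<delta> / 3 + (\<delta> / 3 + \<delta> / 3)) (\<lambda>n \<omega>.
      (\<forall>i\<in>{..<I}. (p ^ i - \<eta>') * mean_exceed n < exceed n (sample \<omega>) (b ^ i * u n) \<and>
        exceed n (sample \<omega>) (b ^ i * u n) < (p ^ i + \<eta>') * mean_exceed n) \<and>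
      (\<Sum>i=I..<J n. exceed n (sample \<omega>) (b ^ i * u n)) < \<eta> * mean_exceed n \<and>
      exceed n (sample \<omega>) (b ^ J n * u n) < 1)"
    by (intro eventually_outside_conj)
  hence "eventually_outside \<delta> (\<lambda>n \<omega>.
      (\<forall>i\<in>{..<I}. (p ^ i - \<eta>') * mean_exceed n < exceed n (sample \<omega>) (b ^ i * u n) \<and>
        exceed n (sample \<omega>) (b ^ i * u n) < (p ^ i + \<eta>') * mean_exceed n) \<and>
      (\<Sum>i=I..<J n. exceed n (sample \<omega>) (b ^ i * u n)) < \<eta> * mean_exceed n \<and>
      exceed n (sample \<omega>) (b ^ J n * u n) < 1)"
    by simp
  thus "eventually_outside \<delta> (\<lambda>n \<omega>. log_excess n (sample \<omega>) (u n) < c * mean_exceed n)"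
  proof (rule eventually_outside_mono)
    show "\<forall>\<^sub>F n in sequentially. \<forall>\<omega>\<in>space P.
      (\<forall>i\<in>{..<I}. (p ^ i - \<eta>') * mean_exceed n < exceed n (sample \<omega>) (b ^ i * u n) \<and>
        exceed n (sample \<omega>) (b ^ i * u n) < (p ^ i + \<eta>') * mean_exceed n) \<and>
      (\<Sum>i=I..<J n. exceed n (sample \<omega>) (b ^ i * u n)) < \<eta> * mean_exceed n \<and>
      exceed n (sample \<omega>) (b ^ J n * u n) < 1 \<longrightarrow>
      log_excess n (sample \<omega>) (u n) < c * mean_exceed n"
      using level_pos mean_pos
    proof eventually_elim
      case (elim n)
      show ?case
      proof (intro ballI impI, elim conjE)
        fix \<omega>
        assume main: "\<forall>i\<in>{..<I}. (p ^ i - \<eta>') * mean_exceed n < exceed n (sample \<omega>) (b ^ i * u n) \<and>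
            exceed n (sample \<omega>) (b ^ i * u n) < (p ^ i + \<eta>') * mean_exceed n"
          and rest: "(\<Sum>i=I..<J n. exceed n (sample \<omega>) (b ^ i * u n)) < \<eta> * mean_exceed n"
          and last: "exceed n (sample \<omega>) (b ^ J n * u n) < 1"
        have "(\<Sum>i<I. exceed n (sample \<omega>) (b ^ i * u n)) \<le> (\<Sum>i<I. (p ^ i + \<eta>') * mean_exceed n)"
          using main by (intro sum_mono less_imp_le) auto
        also have "\<dots> = ((\<Sum>i<I. p ^ i) + real I * \<eta>') * mean_exceed n"
          by (simp add: sum_distrib_right[symmetric] sum.distrib del: sum_distrib_right)
        also have "\<dots> \<le> (1 / (1 - p) + \<eta>) * mean_exceed n"
        proof -
          have "(\<Sum>i<I. p ^ i) \<le> 1 / (1 - p)"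
            using sum_geometric_le[of p 0 I] p by (simp add: atLeast0LessThan)
          thus ?thesis using \<eta>' elim by (intro mult_right_mono add_mono) auto
        qed
        finally have *: "(\<Sum>i<I. exceed n (sample \<omega>) (b ^ i * u n)) \<le> (1 / (1 - p) + \<eta>) * mean_exceed n" .
        have "log_excess n (sample \<omega>) (u n) \<le> ln b * (\<Sum>i<J n. exceed n (sample \<omega>) (b ^ i * u n))"
          using b elim last by (intro log_excess_le_exceed) auto
        also have "(\<Sum>i<J n. exceed n (sample \<omega>) (b ^ i * u n)) =
            (\<Sum>i<I. exceed n (sample \<omega>) (b ^ i * u n)) + (\<Sum>i=I..<J n. exceed n (sample \<omega>) (b ^ i * u n))"
          using J[OF elim(1)]
            sum.atLeastLessThan_concat[of 0 I "J n" "\<lambda>i. exceed n (sample \<omega>) (b ^ i * u n)"]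
          by (simp add: atLeast0LessThan)
        also have "ln b * \<dots> < ln b * ((1 / (1 - p) + \<eta>) * mean_exceed n + \<eta> * mean_exceed n)"
          using * rest lnb by (intro mult_strict_left_mono) auto
        also have "\<dots> = (ln b * (1 / (1 - p) + 2 * \<eta>)) * mean_exceed n"
          by (simp add: algebra_simps)
        also have "\<dots> = c * mean_exceed n" by (simp only: \<eta>(2))
        finally show "log_excess n (sample \<omega>) (u n) < c * mean_exceed n" .
      qed
    qed
  qed
qed

end

section \<open>Convergence of the Hill statistic, uniformly over a range of indices\<close>

context intermediate_level
begin

text \<open>The one-level bounds are applied at \<open>t * u n\<close> with its own mean; the ratio
  of the two means tends to \<open>t powr (- \<alpha>)\<close>, and \<open>c\<close>,
  \<open>c'\<close> leave room for that error.\<close>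

lemma log_excess_level:
  assumes t: "t > 0" and lr: "l < t powr (- \<alpha>) / \<alpha>" "t powr (- \<alpha>) / \<alpha> < r"
  shows "whp (\<lambda>n \<omega>. l * mean_exceed n < log_excess n (sample \<omega>) (t * u n) \<and>
    log_excess n (sample \<omega>) (t * u n) < r * mean_exceed n)"
proof -
  interpret scaled: intermediate_level P H F \<alpha> "\<lambda>n. t * u n"
    by (rule scale_level[OF t])
  define p where "p = t powr (- \<alpha>)"
  have p: "p > 0" using t by (simp add: p_def)
  have "l < p / \<alpha>" "p / \<alpha> < r" using lr by (simp_all add: p_def)
  hence "l / p < 1 / \<alpha>" "1 / \<alpha> < r / p"
    using p alpha_pos by (simp_all add: field_simps)
  then obtain c c' where c: "l / p < c" "c < 1 / \<alpha>" and c': "1 / \<alpha> < c'" "c' < r / p"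
    by (meson dense)
  have lim: "(\<lambda>n. k * (F (t * u n) / F (u n))) \<longlonglongrightarrow> k * p" for k
    unfolding p_def by (intro tendsto_mult tendsto_const level_ratio t)
  have "l < c * p" "c' * p < r" using c c' p by (simp_all add: divide_less_eq less_divide_eq)
  hence ev: "\<forall>\<^sub>F n in sequentially. l < c * (F (t * u n) / F (u n))"
      "\<forall>\<^sub>F n in sequentially. c' * (F (t * u n) / F (u n)) < r"
    using order_tendstoD(1)[OF lim[of c], of l] order_tendstoD(2)[OF lim[of c'], of r] by simp_all
  have "whp (\<lambda>n \<omega>. c * (real n * F (t * u n)) < log_excess n (sample \<omega>) (t * u n) \<and>
      log_excess n (sample \<omega>) (t * u n) < c' * (real n * F (t * u n)))"
    using c c' by (intro whp_conj scaled.log_excess_lower scaled.log_excess_upper)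
  moreover from ev mean_pos have "\<forall>\<^sub>F n in sequentially.
      l * mean_exceed n \<le> c * (real n * F (t * u n)) \<and> c' * (real n * F (t * u n)) \<le> r * mean_exceed n"
  proof eventually_elim
    case (elim n)
    have eq: "k * (real n * F (t * u n)) = k * (F (t * u n) / F (u n)) * mean_exceed n" for k
      using tail_pos[of "u n"] by simp
    show ?case unfolding eq using elim by (intro conjI mult_right_mono less_imp_le) auto
  qed
  hence "\<forall>\<^sub>F n in sequentially. \<forall>\<omega>\<in>space P.
      c * (real n * F (t * u n)) < log_excess n (sample \<omega>) (t * u n) \<and>
      log_excess n (sample \<omega>) (t * u n) < c' * (real n * F (t * u n)) \<longrightarrow>
      l * mean_exceed n < log_excess n (sample \<omega>) (t * u n) \<and>
      log_excess n (sample \<omega>) (t * u n) < r * mean_exceed n"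
    by eventually_elim auto
  ultimately show ?thesis by (rule whp_mono)
qed

text \<open>The quantifiers over \<open>k\<close> and \<open>d\<close> stand inside the event so
  that a random index and a random default can be inserted. The range of \<open>k\<close> is covered
  by finitely many bands of ratio \<open>\<theta>\<close>; on each band two levels enclose the
  statistic between \<open>1 / \<theta> ^ 3 / \<alpha>\<close> and
  \<open>\<theta> ^ 3 / \<alpha>\<close>.\<close>

lemma hill_uniform:
  assumes "\<epsilon> > 0"
  shows "whp (\<lambda>n \<omega>. \<forall>k d. mean_exceed n \<le> real k \<longrightarrow> real k \<le> C * mean_exceed n \<longrightarrow> k \<le> n \<longrightarrow>
    \<bar>hill d n (sample \<omega>) k - 1 / \<alpha>\<bar> < \<epsilon>)"
proof -
  have "((\<lambda>\<theta>. \<theta> ^ 3 / \<alpha>) \<longlongrightarrow> 1 ^ 3 / \<alpha>) (at_right 1)"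
      "((\<lambda>\<theta>. 1 / \<theta> ^ 3 / \<alpha>) \<longlongrightarrow> 1 / 1 ^ 3 / \<alpha>) (at_right (1::real))"
    using alpha_pos
    by (intro tendsto_divide tendsto_power tendsto_ident_at tendsto_const; simp)+
  hence "\<forall>\<^sub>F \<theta> in at_right 1. \<theta> ^ 3 / \<alpha> < 1 / \<alpha> + \<epsilon>"
      "\<forall>\<^sub>F \<theta> in at_right 1. 1 / \<theta> ^ 3 / \<alpha> > 1 / \<alpha> - \<epsilon>"
    using assms by (auto elim!: order_tendstoD)
  moreover have "\<forall>\<^sub>F \<theta> in at_right 1. (\<theta>::real) > 1" by (rule eventually_at_right_less)
  ultimately have "\<forall>\<^sub>F \<theta> in at_right 1.
      \<theta> > 1 \<and> \<theta> ^ 3 / \<alpha> < 1 / \<alpha> + \<epsilon> \<and> 1 / \<theta> ^ 3 / \<alpha> > 1 / \<alpha> - \<epsilon>"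
    by eventually_elim simp
  then obtain \<theta> where \<theta>: "\<theta> > 1" "\<theta> ^ 3 / \<alpha> < 1 / \<alpha> + \<epsilon>" "1 / \<theta> ^ 3 / \<alpha> > 1 / \<alpha> - \<epsilon>"
    using eventually_happens'[OF trivial_limit_at_right_real] by blast
  \<comment> \<open>Chosen so that the limiting relative count at \<open>t m * u n\<close> is
    \<open>\<theta> ^ m / \<theta>\<close>, the geometric middle of the window from
    \<open>\<theta> ^ m / \<theta>\<^sup>2\<close> to \<open>\<theta> ^ m\<close> used
    below.\<close>
  define t where "t = (\<lambda>m::nat. (\<theta> ^ m / \<theta>) powr (- (1 / \<alpha>)))"
  have t_pos: "t m > 0" for m using \<theta> by (simp add: t_def)
  have t_powr: "t m powr (- \<alpha>) = \<theta> ^ m / \<theta>" for m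
    using \<theta> alpha_pos by (simp add: t_def powr_powr)
  have t_le: "t (m + 3) \<le> t m" for m
    unfolding t_def using \<theta> alpha_pos
    by (intro powr_mono2' divide_right_mono power_increasing) auto
  obtain A where A: "C < \<theta> ^ A" using real_arch_pow \<theta> by blast
  have bounds: "\<theta> ^ m / \<theta>\<^sup>2 < \<theta> ^ m / \<theta>" "\<theta> ^ m / \<theta> < \<theta> ^ m" for m
    using \<theta> by (auto simp: field_simps power2_eq_square)

  define good where "good = (\<lambda>m n \<omega>.
      (\<theta> ^ m / \<theta>\<^sup>2 * mean_exceed n < exceed n (sample \<omega>) (t m * u n) \<and>
       exceed n (sample \<omega>) (t m * u n) < \<theta> ^ m * mean_exceed n) \<and>
      (\<theta> ^ m / \<theta>\<^sup>2 / \<alpha> * mean_exceed n < log_excess n (sample \<omega>) (t m * u n) \<and>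
       log_excess n (sample \<omega>) (t m * u n) < \<theta> ^ m / \<alpha> * mean_exceed n))"
  have "whp (\<lambda>n \<omega>. \<forall>m\<in>{..A + 3}. good m n \<omega>)"
    unfolding good_def using bounds alpha_pos
    by (intro whp_finite_ball whp_conj exceed_level log_excess_level t_pos finite_atMost)
      (auto simp only: t_powr divide_strict_right_mono)
  moreover have "\<forall>\<^sub>F n in sequentially. \<forall>\<omega>\<in>space P. (\<forall>m\<in>{..A + 3}. good m n \<omega>) \<longrightarrow>
    (\<forall>k d. mean_exceed n \<le> real k \<longrightarrow> real k \<le> C * mean_exceed n \<longrightarrow> k \<le> n \<longrightarrow>
      \<bar>hill d n (sample \<omega>) k - 1 / \<alpha>\<bar> < \<epsilon>)"
    using level_pos mean_pos
  proof eventually_elim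
    case (elim n)
    define w where "w = mean_exceed n"
    have w: "w > 0" using elim by (simp add: w_def)
    show ?case unfolding w_def[symmetric]
    proof (intro ballI impI allI)
      fix \<omega> k d
      assume "\<forall>m\<in>{..A + 3}. good m n \<omega>"
        and k: "w \<le> real k" "real k \<le> C * w" "k \<le> n"
      hence good: "good m n \<omega>" if "m \<le> A + 3" for m using that by simp
      have k1: "k \<ge> 1" using w k by linarith
      \<comment> \<open>The band of \<open>k\<close>:
        \<open>\<theta> ^ m * w \<le> real k < \<theta> ^ (m + 1) * w\<close>. For
        \<open>m = 0\<close> the left inequality is the assumption on \<open>k\<close>.\<close>
      define m where "m = (LEAST m. real k < \<theta> ^ (m + 1) * w)"
      have "C * w < \<theta> ^ A * w" using A w by simp
      also have "\<dots> \<le> \<theta> ^ (A + 1) * w"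
        using w \<theta> by (intro mult_right_mono power_increasing) auto
      finally have kA: "real k < \<theta> ^ (A + 1) * w" using k by linarith
      have m_upper: "real k < \<theta> ^ (m + 1) * w"
        unfolding m_def by (rule LeastI[of _ A]) (fact kA)
      have mA: "m \<le> A" unfolding m_def by (rule Least_le) (fact kA)
      have m_lower: "\<theta> ^ m * w \<le> real k"
      proof (cases m)
        case (Suc i)
        hence "\<not> real k < \<theta> ^ (i + 1) * w"
          using not_less_Least[of i "\<lambda>m. real k < \<theta> ^ (m + 1) * w"] unfolding m_def by simp
        thus ?thesis using Suc by simp
      qed (use k in simp)
      \<comment> \<open>Three bands further the count exceeds
        \<open>\<theta> ^ (m + 3) / \<theta>\<^sup>2 * w\<close>, the upper end of the band of
        \<open>k\<close>. This shift by 3 is why the good event runs up to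
        \<open>A + 3\<close>.\<close>
      have "real k \<le> \<theta> ^ (m + 3) / \<theta>\<^sup>2 * w"
        using m_upper \<theta> by (simp add: power_add power2_eq_square power3_eq_cube mult_ac)
      hence ex: "exceed n (sample \<omega>) (t m * u n) < real k"
          "real k \<le> exceed n (sample \<omega>) (t (m + 3) * u n)"
        using good[of m] good[of "m + 3"] mA m_lower
        unfolding good_def w_def[symmetric] by (auto simp: less_imp_le)
      note between = hill_between[OF k1 k(3) _ _ ex, where d = d]
      have tu: "0 < t (m + 3) * u n" "t (m + 3) * u n \<le> t m * u n"
        using elim t_pos t_le[of m] by auto
      have "1 / \<theta> ^ 3 / \<alpha> * real k < 1 / \<theta> ^ 3 / \<alpha> * (\<theta> ^ (m + 1) * w)"
        using m_upper \<theta> alpha_pos by (intro mult_strict_left_mono) auto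
      also have "\<dots> = \<theta> ^ m / \<theta>\<^sup>2 / \<alpha> * w"
        using \<theta> by (simp add: power_add power2_eq_square power3_eq_cube)
      also have "\<dots> < log_excess n (sample \<omega>) (t m * u n)"
        using good[of m] mA unfolding good_def w_def[symmetric] by simp
      also have "\<dots> \<le> real k * hill d n (sample \<omega>) k" using between(1) tu by blast
      finally have "real k * (1 / \<theta> ^ 3 / \<alpha>) < real k * hill d n (sample \<omega>) k"
        by (simp only: mult.commute)
      hence lower: "1 / \<theta> ^ 3 / \<alpha> < hill d n (sample \<omega>) k"
        by (rule mult_left_less_imp_less) simp
      have "real k * hill d n (sample \<omega>) k \<le> log_excess n (sample \<omega>) (t (m + 3) * u n)"
        using between(2) tu by blast
      also have "\<dots> < \<theta> ^ (m + 3) / \<alpha> * w"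
        using good[of "m + 3"] mA unfolding good_def w_def[symmetric] by simp
      also have "\<dots> = \<theta> ^ 3 / \<alpha> * (\<theta> ^ m * w)" by (simp add: power_add)
      also have "\<dots> \<le> \<theta> ^ 3 / \<alpha> * real k"
        using m_lower \<theta> alpha_pos by (intro mult_left_mono) auto
      finally have "real k * hill d n (sample \<omega>) k < real k * (\<theta> ^ 3 / \<alpha>)"
        by (simp only: mult.commute)
      hence upper: "hill d n (sample \<omega>) k < \<theta> ^ 3 / \<alpha>"
        by (rule mult_left_less_imp_less) simp
      show "\<bar>hill d n (sample \<omega>) k - 1 / \<alpha>\<bar> < \<epsilon>"
        using lower upper \<theta>(2,3) by linarith
    qed
  qed
  ultimately show ?thesis by (rule whp_mono)
qed

end

section \<open>The random number of order statistics\<close>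

context iid_rv_sample
begin

text \<open>At a level \<open>v n\<close> with bounded but large expected count some observation
  lies above \<open>v n\<close>. The maximum then does too, so the count above
  \<open>\<gamma>\<close> times the maximum is at most the count above
  \<open>\<gamma> * v n\<close>, whose mean is bounded.\<close>

lemma exceed_scaled_max_tight:
  assumes \<gamma>: "0 < \<gamma>" "\<gamma> < 1" and \<delta>: "\<delta> > 0"
  shows "\<exists>K>0. eventually_outside \<delta> (\<lambda>n \<omega>.
    1 \<le> exceed n (sample \<omega>) (\<gamma> * Max (sample \<omega> ` {1..n})) \<and>
    exceed n (sample \<omega>) (\<gamma> * Max (sample \<omega> ` {1..n})) \<le> K)"
proof -
  define c where "c = 2 powr (- \<alpha>) / 2"
  have c: "c > 0" by (simp add: c_def)
  \<comment> \<open>With mean \<open>w \<ge> 2\<close>, an empty count deviates by at least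
    \<open>w / 2\<close>; with \<open>w \<ge> 8 / \<delta>\<close> the Chebyshev bound
    \<open>4 / w\<close> is at most \<open>\<delta> / 2\<close>.\<close>
  define L where "L = max (2 / c) (8 / (c * \<delta>))"
  have L: "L > 0" "c * L \<ge> 2" "c * L \<ge> 8 / \<delta>"
    using c \<delta> by (auto simp: L_def max_def field_simps)
  define g where "g = \<gamma> powr (- \<alpha>) + 1"
  have g: "g > 0" by (simp add: g_def add_nonneg_pos)
  \<comment> \<open>Makes the Markov bound \<open>g * L / K\<close> equal to
    \<open>\<delta> / 2\<close>, where \<open>g\<close> eventually bounds the ratio of
    \<open>F\<close> at \<open>\<gamma> * v n\<close> and at \<open>v n\<close>.\<close>
  define K where "K = g * L * 2 / \<delta>"
  have K: "K > 0" using g L \<delta> by (simp add: K_def)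
  have "(\<lambda>n. L / real n) \<longlonglongrightarrow> 0" by real_asymp
  moreover have "\<forall>\<^sub>F n in sequentially. L / real n > 0"
    using eventually_gt_at_top[of 0] by eventually_elim (use L in simp)
  ultimately obtain v where v: "filterlim v at_top sequentially"
      and "\<forall>\<^sub>F n in sequentially. F (v n) \<le> L / real n \<and> c * (L / real n) \<le> F (v n)"
    using tail_quantile_sequence unfolding c_def by blast
  from this(2) have mean: "\<forall>\<^sub>F n in sequentially. real n * F (v n) \<le> L \<and> c * L \<le> real n * F (v n)"
    using eventually_gt_at_top[of 0]
  proof eventually_elim
    case (elim n)
    thus ?case by (auto simp: field_simps)
  qed
  have "eventually_outside (\<delta> / 2) (\<lambda>n \<omega>. 1 \<le> exceed n (sample \<omega>) (v n))"
  proof (rule eventually_outsideI)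
    show "\<forall>\<^sub>F n in sequentially. {\<omega>\<in>space P. \<not> 1 \<le> exceed n (sample \<omega>) (v n)} \<in> events \<and>
        \<P>(\<omega> in P. \<not> 1 \<le> exceed n (sample \<omega>) (v n)) \<le> \<delta> / 2"
      using mean
    proof eventually_elim
      case (elim n)
      define w where "w = real n * F (v n)"
      have w: "w \<ge> 2" "w \<ge> 8 / \<delta>" using elim L unfolding w_def by linarith+
      have "\<P>(\<omega> in P. \<not> 1 \<le> exceed n (sample \<omega>) (v n))
          \<le> \<P>(\<omega> in P. w / 2 \<le> \<bar>exceed n (sample \<omega>) (v n) - w\<bar>)"
        using w by (intro finite_measure_mono) auto
      also have "\<dots> \<le> w / (w / 2)\<^sup>2"
        unfolding w_def by (rule exceed_Chebyshev) (use w in \<open>simp add: w_def\<close>)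
      also have "\<dots> = 4 / w" using w by (simp add: power2_eq_square)
      also have "\<dots> \<le> \<delta> / 2" using w \<delta> by (simp add: field_simps)
      finally show ?case by simp
    qed
  qed
  moreover have "eventually_outside (\<delta> / 2) (\<lambda>n \<omega>. exceed n (sample \<omega>) (\<gamma> * v n) \<le> K)"
  proof (rule eventually_outsideI)
    have "((\<lambda>n. F (\<gamma> * v n) / F (v n)) \<longlongrightarrow> \<gamma> powr (- \<alpha>)) sequentially"
      by (rule filterlim_compose[OF tail_ratio[OF \<gamma>(1)] v])
    hence "\<forall>\<^sub>F n in sequentially. F (\<gamma> * v n) / F (v n) < g"
      by (rule order_tendstoD) (simp add: g_def)
    with mean show "\<forall>\<^sub>F n in sequentially. {\<omega>\<in>space P. \<not> exceed n (sample \<omega>) (\<gamma> * v n) \<le> K} \<in> events \<and>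
        \<P>(\<omega> in P. \<not> exceed n (sample \<omega>) (\<gamma> * v n) \<le> K) \<le> \<delta> / 2"
    proof eventually_elim
      case (elim n)
      have "\<P>(\<omega> in P. \<not> exceed n (sample \<omega>) (\<gamma> * v n) \<le> K)
          \<le> \<P>(\<omega> in P. K \<le> (\<Sum>i\<in>{0::nat}. exceed n (sample \<omega>) (\<gamma> * v n)))"
        by (intro finite_measure_mono) auto
      also have "\<dots> \<le> real n * (\<Sum>i\<in>{0::nat}. F (\<gamma> * v n)) / K"
        by (rule exceed_Markov) fact
      also have "\<dots> \<le> g * L / K"
      proof -
        have "F (\<gamma> * v n) \<le> g * F (v n)"
          using elim tail_pos[of "v n"] by (simp add: divide_less_eq)
        hence "real n * F (\<gamma> * v n) \<le> real n * (g * F (v n))" by (intro mult_left_mono) auto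
        also have "\<dots> = g * (real n * F (v n))" by simp
        also have "\<dots> \<le> g * L" using elim g by (intro mult_left_mono) auto
        finally show ?thesis using K by (intro divide_right_mono) auto
      qed
      also have "\<dots> = \<delta> / 2" using g L \<delta> by (simp add: K_def)
      finally show ?case by simp
    qed
  qed
  ultimately have "eventually_outside (\<delta> / 2 + \<delta> / 2) (\<lambda>n \<omega>.
      1 \<le> exceed n (sample \<omega>) (v n) \<and> exceed n (sample \<omega>) (\<gamma> * v n) \<le> K)"
    by (rule eventually_outside_conj)
  hence "eventually_outside \<delta> (\<lambda>n \<omega>.
      1 \<le> exceed n (sample \<omega>) (v n) \<and> exceed n (sample \<omega>) (\<gamma> * v n) \<le> K)"
    by simp
  moreover have "\<forall>\<^sub>F n in sequentially. v n > 0"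
    using v by (simp add: filterlim_at_top_dense)
  hence "\<forall>\<^sub>F n in sequentially. \<forall>\<omega>\<in>space P.
      1 \<le> exceed n (sample \<omega>) (v n) \<and> exceed n (sample \<omega>) (\<gamma> * v n) \<le> K \<longrightarrow>
      1 \<le> exceed n (sample \<omega>) (\<gamma> * Max (sample \<omega> ` {1..n})) \<and>
      exceed n (sample \<omega>) (\<gamma> * Max (sample \<omega> ` {1..n})) \<le> K"
  proof eventually_elim
    case (elim n)
    show ?case
    proof (intro ballI impI, elim conjE)
      fix \<omega>
      assume 1: "1 \<le> exceed n (sample \<omega>) (v n)" and 2: "exceed n (sample \<omega>) (\<gamma> * v n) \<le> K"
      obtain j where j: "j \<in> {1..n}" "H j \<omega> > v n" using exceed_ge_1_imp[OF 1] by blast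
      have "H j \<omega> \<le> Max (sample \<omega> ` {1..n})" using j by (intro Max_ge) auto
      hence max: "v n < Max (sample \<omega> ` {1..n})" using j by linarith
      hence "exceed n (sample \<omega>) (\<gamma> * Max (sample \<omega> ` {1..n})) \<le> exceed n (sample \<omega>) (\<gamma> * v n)"
        using \<gamma> by (intro exceed_antimono) auto
      moreover have "1 \<le> exceed n (sample \<omega>) (\<gamma> * Max (sample \<omega> ` {1..n}))"
        using max elim \<gamma> j by (intro exceed_scaled_max_ge_1) auto
      ultimately show "1 \<le> exceed n (sample \<omega>) (\<gamma> * Max (sample \<omega> ` {1..n})) \<and>
          exceed n (sample \<omega>) (\<gamma> * Max (sample \<omega> ` {1..n})) \<le> K"
        using 2 by linarith
    qed
  qed
  ultimately have "eventually_outside \<delta> (\<lambda>n \<omega>.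
      1 \<le> exceed n (sample \<omega>) (\<gamma> * Max (sample \<omega> ` {1..n})) \<and>
      exceed n (sample \<omega>) (\<gamma> * Max (sample \<omega> ` {1..n})) \<le> K)"
    by (rule eventually_outside_mono)
  with K show ?thesis by blast
qed

text \<open>Up to the integer part the index is
  \<open>real n powr (1 - \<beta>) * N powr \<beta>\<close> with \<open>N\<close> the count above
  the scaled maximum. As \<open>N\<close> lies between 1 and some \<open>K\<close> with probability
  close to one, the index falls into a range covered by \<open>hill_uniform\<close>.\<close>

lemma hill_k_hat:
  assumes \<gamma>: "0 < \<gamma>" "\<gamma> < 1" and \<beta>: "0 < \<beta>" "\<beta> < 1" and \<epsilon>: "\<epsilon> > 0"
  shows "whp (\<lambda>n \<omega>. \<forall>d. \<bar>hill d n (sample \<omega>) (k_hat \<gamma> \<beta> n (sample \<omega>)) - 1 / \<alpha>\<bar> < \<epsilon>)"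
  unfolding whp_def
proof (intro allI impI)
  fix \<delta> :: real assume \<delta>: "\<delta> > 0"
  define c where "c = 2 powr (- \<alpha>) / 2"
  have c: "c > 0" by (simp add: c_def)
  \<comment> \<open>The factor 1/2 pays for the integer part: \<open>z / 2 \<le> z - 1\<close> as
    soon as \<open>z = real n powr (1 - \<beta>)\<close> is at least 2.\<close>
  have "(\<lambda>n. real n powr (- \<beta>) / 2) \<longlonglongrightarrow> 0" using \<beta> by real_asymp
  moreover have "\<forall>\<^sub>F n in sequentially. real n powr (- \<beta>) / 2 > 0"
    using eventually_gt_at_top[of 0] by eventually_elim simp
  ultimately obtain u where u: "filterlim u at_top sequentially"
      and "\<forall>\<^sub>F n in sequentially. F (u n) \<le> real n powr (- \<beta>) / 2 \<and>
        c * (real n powr (- \<beta>) / 2) \<le> F (u n)"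
    using tail_quantile_sequence unfolding c_def by blast
  from this(2) have mean: "\<forall>\<^sub>F n in sequentially.
      real n * F (u n) \<le> real n powr (1 - \<beta>) / 2 \<and>
      c / 2 * real n powr (1 - \<beta>) \<le> real n * F (u n)"
    using eventually_gt_at_top[of 0]
  proof eventually_elim
    case (elim n)
    have "real n powr (1 - \<beta>) = real n * real n powr (- \<beta>)"
      using elim by (simp add: powr_mult_base)
    thus ?case using elim mult_left_mono[of _ _ "real n"] by (auto simp: mult_ac)
  qed
  interpret intermediate_level P H F \<alpha> u
  proof
    show "filterlim u at_top sequentially" by fact
    have "filterlim (\<lambda>n. c / 2 * real n powr (1 - \<beta>)) at_top sequentially"
      using c \<beta> by real_asymp
    moreover have "\<forall>\<^sub>F n in sequentially. c / 2 * real n powr (1 - \<beta>) \<le> real n * F (u n)"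
      using mean by eventually_elim simp
    ultimately show "filterlim (\<lambda>n. real n * F (u n)) at_top sequentially"
      by (rule filterlim_at_top_mono)
  qed
  obtain K where K: "K > 0" and tight: "eventually_outside (\<delta> / 2) (\<lambda>n \<omega>.
      1 \<le> exceed n (sample \<omega>) (\<gamma> * Max (sample \<omega> ` {1..n})) \<and>
      exceed n (sample \<omega>) (\<gamma> * Max (sample \<omega> ` {1..n})) \<le> K)"
    using exceed_scaled_max_tight[of \<gamma> "\<delta> / 2"] \<gamma> \<delta> by auto
  \<comment> \<open>The largest factor \<open>K powr \<beta>\<close> over the smallest possible
    ratio \<open>c / 2\<close> of the mean to \<open>real n powr (1 - \<beta>)\<close>.\<close>
  define C where "C = K powr \<beta> / (c / 2)"
  have "eventually_outside (\<delta> / 2) (\<lambda>n \<omega>. \<forall>k d. mean_exceed n \<le> real k \<longrightarrow>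
      real k \<le> C * mean_exceed n \<longrightarrow> k \<le> n \<longrightarrow> \<bar>hill d n (sample \<omega>) k - 1 / \<alpha>\<bar> < \<epsilon>)"
    using \<epsilon> \<delta> by (intro whpD hill_uniform) auto
  from eventually_outside_conj[OF tight this]
  have "eventually_outside \<delta> (\<lambda>n \<omega>.
      (1 \<le> exceed n (sample \<omega>) (\<gamma> * Max (sample \<omega> ` {1..n})) \<and>
       exceed n (sample \<omega>) (\<gamma> * Max (sample \<omega> ` {1..n})) \<le> K) \<and>
      (\<forall>k d. mean_exceed n \<le> real k \<longrightarrow> real k \<le> C * mean_exceed n \<longrightarrow> k \<le> n \<longrightarrow>
        \<bar>hill d n (sample \<omega>) k - 1 / \<alpha>\<bar> < \<epsilon>))"
    by simp
  thus "eventually_outside \<delta> (\<lambda>n \<omega>.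
      \<forall>d. \<bar>hill d n (sample \<omega>) (k_hat \<gamma> \<beta> n (sample \<omega>)) - 1 / \<alpha>\<bar> < \<epsilon>)"
  proof (rule eventually_outside_mono)
    have "filterlim (\<lambda>n. real n powr (1 - \<beta>)) at_top sequentially"
      using \<beta> by real_asymp
    hence "\<forall>\<^sub>F n in sequentially. real n powr (1 - \<beta>) \<ge> 2"
      by (simp add: filterlim_at_top)
    with mean show "\<forall>\<^sub>F n in sequentially. \<forall>\<omega>\<in>space P.
      (1 \<le> exceed n (sample \<omega>) (\<gamma> * Max (sample \<omega> ` {1..n})) \<and>
       exceed n (sample \<omega>) (\<gamma> * Max (sample \<omega> ` {1..n})) \<le> K) \<and>
      (\<forall>k d. mean_exceed n \<le> real k \<longrightarrow> real k \<le> C * mean_exceed n \<longrightarrow> k \<le> n \<longrightarrow>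
        \<bar>hill d n (sample \<omega>) k - 1 / \<alpha>\<bar> < \<epsilon>) \<longrightarrow>
      (\<forall>d. \<bar>hill d n (sample \<omega>) (k_hat \<gamma> \<beta> n (sample \<omega>)) - 1 / \<alpha>\<bar> < \<epsilon>)"
      using eventually_gt_at_top[of 0]
    proof eventually_elim
      case (elim n)
      show ?case
      proof (intro ballI impI allI, elim conjE)
        fix \<omega> d
        define N where "N = exceed n (sample \<omega>) (\<gamma> * Max (sample \<omega> ` {1..n}))"
        define k where "k = k_hat \<gamma> \<beta> n (sample \<omega>)"
        assume "1 \<le> exceed n (sample \<omega>) (\<gamma> * Max (sample \<omega> ` {1..n}))"
          and "exceed n (sample \<omega>) (\<gamma> * Max (sample \<omega> ` {1..n})) \<le> K"
          and hill: "\<forall>k d. mean_exceed n \<le> real k \<longrightarrow> real k \<le> C * mean_exceed n \<longrightarrow> k \<le> n \<longrightarrow>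
            \<bar>hill d n (sample \<omega>) k - 1 / \<alpha>\<bar> < \<epsilon>"
        hence N: "1 \<le> N" "N \<le> K" by (auto simp: N_def)
        define y where "y = real n * (N / real n) powr \<beta>"
        have y: "y = real n powr (1 - \<beta>) * N powr \<beta>"
          using elim N by (simp add: y_def powr_divide powr_diff)
        have k: "k = nat \<lfloor>y\<rfloor>" by (simp add: k_def k_hat_exceed y_def N_def)
        have "1 \<le> N powr \<beta>" using N \<beta> by (simp add: ge_one_powr_ge_zero)
        hence y_lower: "real n powr (1 - \<beta>) \<le> y"
          unfolding y by (simp add: mult_le_cancel_left1)
        have "mean_exceed n \<le> real n powr (1 - \<beta>) / 2" using elim by simp
        also have "\<dots> \<le> y - 1" using y_lower elim(2) by linarith
        also have "\<dots> \<le> real k" unfolding k by linarith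
        finally have 1: "mean_exceed n \<le> real k" .
        have "real k \<le> y" unfolding k using y_lower elim(2) by linarith
        also have "y \<le> real n powr (1 - \<beta>) * K powr \<beta>"
          unfolding y using N \<beta> by (intro mult_left_mono powr_mono2) auto
        also have "\<dots> = C * (c / 2 * real n powr (1 - \<beta>))" using c by (simp add: C_def)
        also have "\<dots> \<le> C * mean_exceed n"
          using elim c by (intro mult_left_mono) (auto simp: C_def)
        finally have 2: "real k \<le> C * mean_exceed n" .
        have "k \<le> n" unfolding k_def using \<beta> by (intro k_hat_le)
        with hill 1 2 show "\<bar>hill d n (sample \<omega>) (k_hat \<gamma> \<beta> n (sample \<omega>)) - 1 / \<alpha>\<bar> < \<epsilon>"
          unfolding k_def by blast
      qed
    qed
  qed
qed

end

section \<open>Transfer from the untruncated to the truncated sample\<close>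

theorem theorem3p3:
  fixes P :: "'a measure"
    and H R :: "nat \<Rightarrow> 'a \<Rightarrow> real"
    and M :: "nat \<Rightarrow> real"
    and d :: "nat \<Rightarrow> nat \<Rightarrow> 'a \<Rightarrow> real"
    and \<alpha> \<beta> \<gamma> :: real
  defines "X \<equiv> truncated_sample M H R"
  assumes "prob_space P"
    and "\<alpha> > 0"
    and "iid_real P H"
    and "\<And>j. j \<ge> 1 \<Longrightarrow> AE \<omega> in P. H j \<omega> \<ge> 0"
    and "regularly_varying (\<lambda>x. \<P>(\<omega> in P. H 1 \<omega> > x)) (- \<alpha>)"
    and "iid_real P R"
    and "\<And>j. j \<ge> 1 \<Longrightarrow> AE \<omega> in P. R j \<omega> \<ge> 0"
    and "indep_sequences P H R"
    and "\<And>n. n \<ge> 1 \<Longrightarrow> M n > 0"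
    and "(\<lambda>n. real n * \<P>(\<omega> in P. H 1 \<omega> > M n)) \<longlonglongrightarrow> 0"
    and "0 < \<gamma>" "\<gamma> < 1"
    and "0 < \<beta>" "\<beta> < 1"
    and "\<And>n k. d n k \<in> borel_measurable P"
  shows "tendsto_in_probability P
    (\<lambda>n \<omega>. let k = k_hat \<gamma> \<beta> n (X n \<omega>) in hill (d n k \<omega>) n (X n \<omega>) k) (1 / \<alpha>)"
proof -
  interpret prob_space P by fact
  have H: "H j \<in> borel_measurable P" and R: "R j \<in> borel_measurable P" if "j \<ge> 1" for j
    using assms(4,7) that unfolding iid_real_def by (simp_all add: indep_vars_def)
  define F where "F = (\<lambda>x. \<P>(\<omega> in P. H 1 \<omega> > x))"
  have "F y \<le> F x" if "x \<le> y" for x y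
    unfolding F_def using H[of 1] that by (intro finite_measure_mono) auto
  then interpret rv_tail F \<alpha>
    using assms(3,6) by (intro regularly_varying_tail) (simp_all add: F_def)
  interpret iid_rv_sample P H F \<alpha>
    by unfold_locales (use assms(4) in \<open>simp_all add: F_def\<close>)
  define Y where "Y = (\<lambda>n \<omega>. let k = k_hat \<gamma> \<beta> n (X n \<omega>) in hill (d n k \<omega>) n (X n \<omega>) k)"
  have Y_meas [measurable]: "Y n \<in> borel_measurable P" for n
    unfolding Y_def Let_def
  proof (rule measurable_hill_k_hat)
    fix j assume "j \<in> {1..n}"
    hence [measurable]: "H j \<in> borel_measurable P" "R j \<in> borel_measurable P" using H R by auto
    show "(\<lambda>\<omega>. X n \<omega> j) \<in> borel_measurable P"
      unfolding X_def truncated_sample_def of_bool_def by measurable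
  qed (use assms in auto)
  \<comment> \<open>Soft truncation enters here: the expected number of observations above
    \<open>M n\<close> tends to 0, so with high probability there are none.\<close>
  have "whp (\<lambda>n \<omega>. exceed n (sample \<omega>) (M n) < 1)"
  proof (rule whpI)
    show "\<forall>\<^sub>F n in sequentially. \<P>(\<omega> in P. \<not> exceed n (sample \<omega>) (M n) < 1) \<le> real n * F (M n)"
    proof (intro always_eventually allI)
      fix n
      show "\<P>(\<omega> in P. \<not> exceed n (sample \<omega>) (M n) < 1) \<le> real n * F (M n)"
        using exceed_Markov[where a = 1 and I = "{0::nat}" and n = n and v = "\<lambda>_. M n"]
        by (simp add: not_less)
    qed
    show "(\<lambda>n. real n * F (M n)) \<longlonglongrightarrow> 0" unfolding F_def by fact
  qed measurable
  hence conv: "whp (\<lambda>n \<omega>. \<bar>Y n \<omega> - 1 / \<alpha>\<bar> \<le> \<epsilon>)" if "\<epsilon> > 0" for \<epsilon>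
  proof (rule whp_mono[OF whp_conj[OF _ hill_k_hat[OF assms(12-15) that]]],
      intro always_eventually allI ballI impI, elim conjE)
    fix n \<omega>
    assume no_exceed: "exceed n (sample \<omega>) (M n) < 1"
      and hill: "\<forall>d. \<bar>hill d n (sample \<omega>) (k_hat \<gamma> \<beta> n (sample \<omega>)) - 1 / \<alpha>\<bar> < \<epsilon>"
    have eq: "X n \<omega> j = H j \<omega>" if j: "j \<in> {1..n}" for j
    proof -
      have "H j \<omega> \<le> M n"
      proof (rule ccontr)
        assume "\<not> H j \<omega> \<le> M n"
        moreover have "of_bool (H j \<omega> > M n) \<le> exceed n (sample \<omega>) (M n)"
          unfolding exceed_def using j by (intro member_le_sum) auto
        ultimately show False using no_exceed by simp
      qed
      thus ?thesis by (simp add: X_def truncated_sample_def)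
    qed
    \<comment> \<open>Both the index and the statistic depend only on the first \<open>n\<close>
      values, which agree with those of \<open>H\<close>. The bound for every \<open>d\<close>
      covers the random, index-dependent default in \<open>Y\<close>.\<close>
    have "\<bar>hill d n (X n \<omega>) (k_hat \<gamma> \<beta> n (X n \<omega>)) - 1 / \<alpha>\<bar> < \<epsilon>" for d
      using hill hill_cong[of n "X n \<omega>" "sample \<omega>"] k_hat_cong[of n "X n \<omega>" "sample \<omega>"] eq
      by simp
    thus "\<bar>Y n \<omega> - 1 / \<alpha>\<bar> \<le> \<epsilon>" by (simp add: Y_def Let_def less_imp_le)
  qed
  have "(\<lambda>n. \<P>(\<omega> in P. \<not> \<bar>Y n \<omega> - 1 / \<alpha>\<bar> \<le> \<epsilon>)) \<longlonglongrightarrow> 0" if "\<epsilon> > 0" for \<epsilon>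
    by (rule whp_imp_tendsto_0[OF conv[OF that]]) measurable
  hence "tendsto_in_probability P Y (1 / \<alpha>)"
    unfolding tendsto_in_probability_def not_le using Y_meas by blast
  thus ?thesis unfolding Y_def .
qed

end
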